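(* Let $\mathcal{C}$ be a symmetrically self-dual (finite-dimensional, symmetric) monoidal category of convex operational models. Then $\mathcal{C}$ is dagger compact, with $\dagger$ given by the canonical adjoint $' : \mathcal{C}^{op} \rightarrow \mathcal{C}$ (associated with the compact structure $(A,\gamma_A,f_A)$, $\gamma_A$ symmetric, on each $A \in \mathcal{C}$).
   Context: All vector spaces are finite-dimensional and real; $V^*$ is the dual space. A cone is regular if it is closed, convex, pointed and generating. A linear map between ordered vector spaces is positive if it maps the positive cone into the positive cone. A convex operational model (COM) is a triple $(A, A^{\#}, u_A)$, abbreviated $A$, where $A$ is an ordered vector space with regular cone $A_+$, $u_A \in A^*$ is strictly positive on $A_+\setminus\{0\}$, and $A^{\#}$ is the vector space $A^*$ ordered by a chosen regular cone $A^{\#}_+ \subseteq A^*_+ = \{a \in A^* : a(\alpha)\ge 0\ \forall \alpha\in A_+\}$ with $u_A \in A^{\#}_+$. A morphism of COMs $A \to B$ is a positive linear map $\phi: A\to B$ with $\phi^*(B^{\#}_+)\subseteq A^{\#}_+$. These form a category $\mathbf{Com}$. Let $I = (\mathbb{R},\mathbb{R},1)$ with the standard cones. A category of COMs is a subcategory $\mathcal{C}$ of $\mathbf{Com}$ such that each $\mathcal{C}(A,B)$ is a regular sub-cone of the cone of COM morphisms $A \to B$, $I \in \mathcal{C}$, $\mathcal{C}(I,A)\simeq A$ (every $\alpha \in A_+$ is identified with the morphism $t\mapsto t\alpha$, so $\mathcal{C}(I,A)=A_+$), and $\mathcal{C}(A,I)\simeq A^{\#}$ (so $\mathcal{C}(A,I)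 = A^{\#}_+$). A composite of COMs $A,B$ is a COM $(AB,(AB)^{\#},u_{AB})$ with $AB$ contained in the space of bilinear forms on $A^{\#}\times B^{\#}$ (hence, as a vector space, $A\otimes B$), $u_{AB} = u_A\otimes u_B$, $\alpha\otimes\beta \in (AB)_+$ for all $\alpha\in A_+,\beta\in B_+$ (where $(\alpha\otimes\beta)(a,b)=a(\alpha)b(\beta)$), and $a\otimes b\in (AB)^{\#}_+$ for all $a\in A^{\#}_+, b\in B^{\#}_+$. A monoidal category of COMs is a category of COMs with a symmetric monoidal structure whose unit is $I$ and in which each $A\otimes B$ is a composite of $A$ and $B$ in this sense. The tensor product of morphisms, the associativity and unit isomorphisms (treated as identities) and the symmetries $\sigma_{A,B}$ are those of the usual tensor product of vector spaces. For $\gamma\in (A\otimes B)_+=\mathcal{C}(I,A\otimes B)$ define $\hat\gamma: A^{\#}\to B$ by $\hat\gamma(a) = (a\otimes 1_B)\circ\gamma$; for $f\in (A\otimes B)^{\#}_+=\mathcal{C}(A\otimes B,I)$ define $\hat f: A\to B^{\#}$ by $\hat f(\alpha) (\beta)=f(\alpha\otimes\beta)$. $\mathcal{C}$ is weakly self-dual if for every $A\in\mathcal{C}$ there is a pair $(\gamma_A,f_A)$ with $\gamma_A \in (A\otimes A)_+$ (a possibly un-normalized bipartite state) and $f_A \in (A\otimes A)^{\#}_+$ such that $\hat\gamma_A: A^{\#}\to A$ is an order-isomorphism and $\hat f_A = \hat\gamma_A^{-1}$. It is symmetrically self-dual if moreover $\gamma_A$ can be chosen symmetric ($\sigma_{A,A}\circ\gamma_A=\gamma_A$)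 for every $A\in\mathcal{C}$. A dual for $A$ is a triple $(A',\eta_A,\epsilon_A)$ with $\eta_A: I\to A'\otimes A$, $\epsilon_A: A\otimes A'\to I$ such that $(\epsilon_A\otimes 1_A)\circ(1_A\otimes\eta_A)=1_A$ and $(1_{A'}\otimes\epsilon_A)\circ(\eta_A\otimes 1_{A'})=1_{A'}$; $\mathcal{C}$ is compact closed if every object has a dual. A weakly self-dual $\mathcal{C}$ is regarded as compact closed with the compact structure $A'=A$, $\eta_A=\gamma_A$, $\epsilon_A=f_A$. Standing convention: the chosen structures are compatible with tensor products (it is assumed that such a choice is possible), i.e. $\gamma_I=f_I=1_I$, $\gamma_{A\otimes B} = (1_A\otimes\sigma_{A,B}\otimes 1_B)\circ(\gamma_A\otimes\gamma_B)$ and $f_{A\otimes B}=(f_A\otimes f_B)\circ(1_A\otimes\sigma_{B,A}\otimes 1_B)$. The canonical adjoint of $\phi\in\mathcal{C}(A,B)$ is $\phi'=(1_{A}\otimes f_B)\circ(1_{A}\otimes\phi\otimes 1_{B})\circ(\gamma_A\otimes 1_{B})\in\mathcal{C}(B,A)$. A dagger on $\mathcal{C}$ is a functor $(-)^\dagger:\mathcal{C}^{op}\to\mathcal{C}$ that is the identity on objects with $\phi^{\dagger\dagger}=\phi$. A morphism $\phi$ is unitary if $\phi^\dagger=\phi^{-1}$. A dagger-monoidal category is a symmetric monoidal category with a dagger such that the canonical isomorphisms of the symmetric monoidal structure are unitary and $(\phi\otimes\psi)^\dagger=\phi^\dagger\otimes\psi^\dagger$. It is dagger compact if it is compact closed and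 $\eta_A=\sigma_{A,A'}\circ\epsilon_A^\dagger$ for every $A$. *)

theory Defs
  imports "HOL-Analysis.Analysis" "HOL-Library.Function_Algebras"
begin

section \<open>Linear maps between subspaces\<close>

text \<open>
  Functions into a vector space form a vector space under the pointwise operations (with the
  product topology of the library), so that dual spaces and spaces of linear maps can use the same
  vector-space and cone notions as the spaces themselves.
\<close>

instantiation "fun" :: (type, real_vector) real_vector
begin

definition scaleR_fun :: "real \<Rightarrow> ('a \<Rightarrow> 'b) \<Rightarrow> 'a \<Rightarrow> 'b" where
  "scaleR_fun c f = (\<lambda>x. c *\<^sub>R f x)"

instance
  by standard (auto simp: scaleR_fun_def plus_fun_def scaleR_add_right scaleR_add_left)

end

text \<open>
  Vector spaces are finite-dimensional subspaces of one ambient normed space, which supplies nothing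
  but the room and the canonical topology on them. A linear map \<open>V \<rightarrow> W\<close> is represented by the
  total function that agrees with it on \<open>V\<close> and is \<open>0\<close> outside \<open>V\<close>, so that it is determined by its
  values on \<open>V\<close>, and composition is \<open>\<circ>\<close>.
\<close>

definition lin_maps :: "'a::real_vector set \<Rightarrow> 'b::real_vector set \<Rightarrow> ('a \<Rightarrow> 'b) set" where
  "lin_maps V W = {f. (\<forall>x\<in>V. f x \<in> W) \<and> (\<forall>x\<in>V. \<forall>y\<in>V. f (x + y) = f x + f y) \<and>
     (\<forall>c. \<forall>x\<in>V. f (c *\<^sub>R x) = c *\<^sub>R f x) \<and> (\<forall>x. x \<notin> V \<longrightarrow> f x = 0)}"

definition dual_space :: "'a::real_vector set \<Rightarrow> ('a \<Rightarrow> real) set" where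
  "dual_space V = lin_maps V UNIV"

text \<open>Curried: a bilinear form sends a vector of \<open>V\<close>, linearly, to a linear functional on \<open>W\<close>.\<close>

definition bilinear_forms :: "'a::real_vector set \<Rightarrow> 'b::real_vector set \<Rightarrow> ('a \<Rightarrow> 'b \<Rightarrow> real) set" where
  "bilinear_forms V W = lin_maps V (dual_space W)"

definition findim_space :: "'a::real_vector set \<Rightarrow> bool" where
  "findim_space V \<longleftrightarrow> subspace V \<and> (\<exists>B. finite B \<and> span B = V)"

definition regular_cone :: "'a::{real_vector,topological_space} set \<Rightarrow> 'a set \<Rightarrow> bool" where
  "regular_cone V K \<longleftrightarrow> K \<noteq> {} \<and> cone K \<and> closed K \<and> convex K \<and>
     (\<forall>x. x \<in> K \<and> - x \<in> K \<longrightarrow> x = 0) \<and> {x - y |x y. x \<in> K \<and> y \<in> K} = V"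

text \<open>Isomorphism of the ordered vector spaces \<open>(V, K)\<close> and \<open>(W, L)\<close>.\<close>

definition order_isomorphism ::
  "'a::real_vector set \<Rightarrow> 'a set \<Rightarrow> 'b::real_vector set \<Rightarrow> 'b set \<Rightarrow> ('a \<Rightarrow> 'b) \<Rightarrow> bool" where
  "order_isomorphism V K W L f \<longleftrightarrow> f \<in> lin_maps V W \<and> bij_betw f V W \<and> f ` K = L"


section \<open>Convex operational models\<close>

text \<open>
  \<open>eff A\<close> is the cone of \<open>A\<^sup>#\<close>; the underlying vector space of \<open>A\<^sup>#\<close> is \<open>dual_space (vspace A)\<close>.
\<close>

record 'v com =
  vspace :: "'v set"
  pos :: "'v set"
  eff :: "('v \<Rightarrow> real) set"
  ounit :: "'v \<Rightarrow> real"

definition is_com :: "'v::real_normed_vector com \<Rightarrow> bool" where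
  "is_com A \<longleftrightarrow> findim_space (vspace A) \<and> regular_cone (vspace A) (pos A) \<and>
     ounit A \<in> dual_space (vspace A) \<and> (\<forall>x\<in>pos A. x \<noteq> 0 \<longrightarrow> 0 < ounit A x) \<and>
     regular_cone (dual_space (vspace A)) (eff A) \<and>
     eff A \<subseteq> {a \<in> dual_space (vspace A). \<forall>x\<in>pos A. 0 \<le> a x} \<and> ounit A \<in> eff A"

definition com_morphisms :: "'v::real_normed_vector com \<Rightarrow> 'v com \<Rightarrow> ('v \<Rightarrow> 'v) set" where
  "com_morphisms A B = {\<phi> \<in> lin_maps (vspace A) (vspace B).
     \<phi> ` pos A \<subseteq> pos B \<and> (\<forall>b\<in>eff B. b \<circ> \<phi> \<in> eff A)}"

definition ident :: "'v::real_normed_vector com \<Rightarrow> 'v \<Rightarrow> 'v" where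
  "ident A = (\<lambda>x. if x \<in> vspace A then x else 0)"

text \<open>
  The COM \<open>(\<real>, \<real>, 1)\<close>, with \<open>\<real>\<close> realised inside the ambient space as the line through a nonzero
  vector \<open>e\<close>, the number \<open>t\<close> being represented by \<open>t *\<^sub>R e\<close>.
\<close>

definition coord :: "'v::real_vector \<Rightarrow> 'v \<Rightarrow> real" where
  "coord e x = (if x \<in> span {e} then (THE t. x = t *\<^sub>R e) else 0)"

definition scalar_com :: "'v::real_normed_vector \<Rightarrow> 'v com" where
  "scalar_com e = \<lparr>vspace = span {e}, pos = {t *\<^sub>R e |t. 0 \<le> t},
     eff = {a \<in> dual_space (span {e}). 0 \<le> a e}, ounit = coord e\<rparr>"


section \<open>Categories of convex operational models\<close>

text \<open>
  Data of a monoidal category of COMs: the objects, the hom-sets, the vector \<open>e\<close> spanning the unit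
  object, the tensor product of objects, and the realisation of the vectors of \<open>tens A B\<close> as
  bilinear forms on \<open>A\<^sup># \<times> B\<^sup>#\<close>. The realisation is needed because the space of all such forms does
  not lie in the ambient space.
\<close>

record 'v com_cat =
  objs :: "'v com set"
  hom :: "'v com \<Rightarrow> 'v com \<Rightarrow> ('v \<Rightarrow> 'v) set"
  uvec :: "'v"
  tens :: "'v com \<Rightarrow> 'v com \<Rightarrow> 'v com"
  form :: "'v com \<Rightarrow> 'v com \<Rightarrow> 'v \<Rightarrow> ('v \<Rightarrow> real) \<Rightarrow> ('v \<Rightarrow> real) \<Rightarrow> real"

definition unit_obj :: "('v::real_normed_vector, 'z) com_cat_scheme \<Rightarrow> 'v com" where
  "unit_obj C = scalar_com (uvec C)"

definition of_state :: "('v::real_normed_vector, 'z) com_cat_scheme \<Rightarrow> 'v \<Rightarrow> 'v \<Rightarrow> 'v" where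
  "of_state C \<alpha> = (\<lambda>x. coord (uvec C) x *\<^sub>R \<alpha>)"

definition of_effect :: "('v::real_normed_vector, 'z) com_cat_scheme \<Rightarrow> ('v \<Rightarrow> real) \<Rightarrow> 'v \<Rightarrow> 'v" where
  "of_effect C a = (\<lambda>x. a x *\<^sub>R uvec C)"

definition com_category :: "('v::real_normed_vector, 'z) com_cat_scheme \<Rightarrow> bool" where
  "com_category C \<longleftrightarrow>
     (\<forall>A\<in>objs C. is_com A) \<and>
     (\<forall>A\<in>objs C. ident A \<in> hom C A A) \<and>
     (\<forall>A\<in>objs C. \<forall>B\<in>objs C. \<forall>D\<in>objs C. \<forall>\<phi>\<in>hom C A B. \<forall>\<psi>\<in>hom C B D. \<psi> \<circ> \<phi> \<in> hom C A D) \<and>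
     (\<forall>A\<in>objs C. \<forall>B\<in>objs C. hom C A B \<subseteq> com_morphisms A B \<and>
        regular_cone (lin_maps (vspace A) (vspace B)) (hom C A B)) \<and>
     uvec C \<noteq> 0 \<and> unit_obj C \<in> objs C \<and>
     (\<forall>A\<in>objs C. hom C (unit_obj C) A = of_state C ` pos A) \<and>
     (\<forall>A\<in>objs C. hom C A (unit_obj C) = of_effect C ` eff A)"


section \<open>Composites and the tensor product\<close>

definition product_form ::
  "'v::real_normed_vector com \<Rightarrow> 'v com \<Rightarrow> 'v \<Rightarrow> 'v \<Rightarrow> ('v \<Rightarrow> real) \<Rightarrow> ('v \<Rightarrow> real) \<Rightarrow> real" where
  "product_form A B \<alpha> \<beta> = (\<lambda>a b.
     if a \<in> dual_space (vspace A) \<and> b \<in> dual_space (vspace B) then a \<alpha> * b \<beta> else 0)"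

text \<open>
  \<open>F\<close> identifies the vectors of \<open>AB\<close> with bilinear forms. Under this identification the functional
  \<open>a \<otimes> b\<close> on \<open>AB\<close> is evaluation at \<open>(a, b)\<close>.
\<close>

definition is_composite :: "'v::real_normed_vector com \<Rightarrow> 'v com \<Rightarrow> 'v com \<Rightarrow>
    ('v \<Rightarrow> ('v \<Rightarrow> real) \<Rightarrow> ('v \<Rightarrow> real) \<Rightarrow> real) \<Rightarrow> bool" where
  "is_composite A B AB F \<longleftrightarrow> is_com AB \<and>
     F \<in> lin_maps (vspace AB) (bilinear_forms (dual_space (vspace A)) (dual_space (vspace B))) \<and>
     inj_on F (vspace AB) \<and>
     ounit AB = (\<lambda>\<omega>. F \<omega> (ounit A) (ounit B)) \<and>
     (\<forall>\<alpha>\<in>pos A. \<forall>\<beta>\<in>pos B. product_form A B \<alpha> \<beta> \<in> F ` pos AB) \<and>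
     (\<forall>a\<in>eff A. \<forall>b\<in>eff B. (\<lambda>\<omega>. F \<omega> a b) \<in> eff AB)"

definition tvec :: "('v::real_normed_vector, 'z) com_cat_scheme \<Rightarrow> 'v com \<Rightarrow> 'v com \<Rightarrow> 'v \<Rightarrow> 'v \<Rightarrow> 'v"
  where "tvec C A B \<alpha> \<beta> = inv_into (vspace (tens C A B)) (form C A B) (product_form A B \<alpha> \<beta>)"

text \<open>
  The structural maps are those of the tensor product of vector spaces, each of them being the
  unique linear map with the given values on product vectors. The objects \<open>(A \<otimes> B) \<otimes> D\<close> and
  \<open>A \<otimes> (B \<otimes> D)\<close>, and likewise \<open>I \<otimes> A\<close>, \<open>A\<close> and \<open>A \<otimes> I\<close>, are not required to be equal.
\<close>

definition tmor :: "('v::real_normed_vector, 'z) com_cat_scheme \<Rightarrow> 'v com \<Rightarrow> 'v com \<Rightarrow> 'v com \<Rightarrow>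
    'v com \<Rightarrow> ('v \<Rightarrow> 'v) \<Rightarrow> ('v \<Rightarrow> 'v) \<Rightarrow> 'v \<Rightarrow> 'v" where
  "tmor C A B A' B' \<phi> \<psi> =
     (THE \<theta>. \<theta> \<in> lin_maps (vspace (tens C A B)) (vspace (tens C A' B')) \<and>
       (\<forall>\<alpha>\<in>vspace A. \<forall>\<beta>\<in>vspace B. \<theta> (tvec C A B \<alpha> \<beta>) = tvec C A' B' (\<phi> \<alpha>) (\<psi> \<beta>)))"

definition assoc :: "('v::real_normed_vector, 'z) com_cat_scheme \<Rightarrow> 'v com \<Rightarrow> 'v com \<Rightarrow> 'v com \<Rightarrow> 'v \<Rightarrow> 'v"
  where
  "assoc C A B D =
     (THE \<theta>. \<theta> \<in> lin_maps (vspace (tens C (tens C A B) D)) (vspace (tens C A (tens C B D))) \<and>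
       (\<forall>\<alpha>\<in>vspace A. \<forall>\<beta>\<in>vspace B. \<forall>\<delta>\<in>vspace D.
          \<theta> (tvec C (tens C A B) D (tvec C A B \<alpha> \<beta>) \<delta>) = tvec C A (tens C B D) \<alpha> (tvec C B D \<beta> \<delta>)))"

definition assoc_inv :: "('v::real_normed_vector, 'z) com_cat_scheme \<Rightarrow> 'v com \<Rightarrow> 'v com \<Rightarrow> 'v com \<Rightarrow> 'v \<Rightarrow> 'v"
  where
  "assoc_inv C A B D =
     (THE \<theta>. \<theta> \<in> lin_maps (vspace (tens C A (tens C B D))) (vspace (tens C (tens C A B) D)) \<and>
       (\<forall>\<alpha>\<in>vspace A. \<forall>\<beta>\<in>vspace B. \<forall>\<delta>\<in>vspace D.
          \<theta> (tvec C A (tens C B D) \<alpha> (tvec C B D \<beta> \<delta>)) = tvec C (tens C A B) D (tvec C A B \<alpha> \<beta>) \<delta>))"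

definition lunit :: "('v::real_normed_vector, 'z) com_cat_scheme \<Rightarrow> 'v com \<Rightarrow> 'v \<Rightarrow> 'v" where
  "lunit C A =
     (THE \<theta>. \<theta> \<in> lin_maps (vspace (tens C (unit_obj C) A)) (vspace A) \<and>
       (\<forall>t. \<forall>\<alpha>\<in>vspace A. \<theta> (tvec C (unit_obj C) A (t *\<^sub>R uvec C) \<alpha>) = t *\<^sub>R \<alpha>))"

definition lunit_inv :: "('v::real_normed_vector, 'z) com_cat_scheme \<Rightarrow> 'v com \<Rightarrow> 'v \<Rightarrow> 'v" where
  "lunit_inv C A = (\<lambda>\<alpha>. if \<alpha> \<in> vspace A then tvec C (unit_obj C) A (uvec C) \<alpha> else 0)"

definition runit :: "('v::real_normed_vector, 'z) com_cat_scheme \<Rightarrow> 'v com \<Rightarrow> 'v \<Rightarrow> 'v" where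
  "runit C A =
     (THE \<theta>. \<theta> \<in> lin_maps (vspace (tens C A (unit_obj C))) (vspace A) \<and>
       (\<forall>t. \<forall>\<alpha>\<in>vspace A. \<theta> (tvec C A (unit_obj C) \<alpha> (t *\<^sub>R uvec C)) = t *\<^sub>R \<alpha>))"

definition runit_inv :: "('v::real_normed_vector, 'z) com_cat_scheme \<Rightarrow> 'v com \<Rightarrow> 'v \<Rightarrow> 'v" where
  "runit_inv C A = (\<lambda>\<alpha>. if \<alpha> \<in> vspace A then tvec C A (unit_obj C) \<alpha> (uvec C) else 0)"

definition symm :: "('v::real_normed_vector, 'z) com_cat_scheme \<Rightarrow> 'v com \<Rightarrow> 'v com \<Rightarrow> 'v \<Rightarrow> 'v" where
  "symm C A B =
     (THE \<theta>. \<theta> \<in> lin_maps (vspace (tens C A B)) (vspace (tens C B A)) \<and>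
       (\<forall>\<alpha>\<in>vspace A. \<forall>\<beta>\<in>vspace B. \<theta> (tvec C A B \<alpha> \<beta>) = tvec C B A \<beta> \<alpha>))"


section \<open>Monoidal categories of convex operational models\<close>

definition inverse_morphisms :: "('v::real_normed_vector, 'z) com_cat_scheme \<Rightarrow> 'v com \<Rightarrow> 'v com \<Rightarrow>
    ('v \<Rightarrow> 'v) \<Rightarrow> ('v \<Rightarrow> 'v) \<Rightarrow> bool" where
  "inverse_morphisms C A B \<phi> \<psi> \<longleftrightarrow>
     \<phi> \<in> hom C A B \<and> \<psi> \<in> hom C B A \<and> \<psi> \<circ> \<phi> = ident A \<and> \<phi> \<circ> \<psi> = ident B"

definition symmetric_monoidal :: "('v::real_normed_vector, 'z) com_cat_scheme \<Rightarrow> bool" where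
  "symmetric_monoidal C \<longleftrightarrow> (let Ob = objs C; I = unit_obj C; T = tens C in
     (\<forall>A\<in>Ob. \<forall>B\<in>Ob. T A B \<in> Ob) \<and>
     (\<forall>A\<in>Ob. \<forall>B\<in>Ob. \<forall>A'\<in>Ob. \<forall>B'\<in>Ob. \<forall>\<phi>\<in>hom C A A'. \<forall>\<psi>\<in>hom C B B'.
        tmor C A B A' B' \<phi> \<psi> \<in> hom C (T A B) (T A' B')) \<and>
     (\<forall>A\<in>Ob. \<forall>B\<in>Ob. tmor C A B A B (ident A) (ident B) = ident (T A B)) \<and>
     (\<forall>A\<in>Ob. \<forall>B\<in>Ob. \<forall>A'\<in>Ob. \<forall>B'\<in>Ob. \<forall>A''\<in>Ob. \<forall>B''\<in>Ob.
        \<forall>\<phi>\<in>hom C A A'. \<forall>\<psi>\<in>hom C B B'. \<forall>\<phi>'\<in>hom C A' A''. \<forall>\<psi>'\<in>hom C B' B''.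
        tmor C A B A'' B'' (\<phi>' \<circ> \<phi>) (\<psi>' \<circ> \<psi>) = tmor C A' B' A'' B'' \<phi>' \<psi>' \<circ> tmor C A B A' B' \<phi> \<psi>) \<and>
     (\<forall>A\<in>Ob. \<forall>B\<in>Ob. \<forall>D\<in>Ob.
        inverse_morphisms C (T (T A B) D) (T A (T B D)) (assoc C A B D) (assoc_inv C A B D)) \<and>
     (\<forall>A\<in>Ob. inverse_morphisms C (T I A) A (lunit C A) (lunit_inv C A)) \<and>
     (\<forall>A\<in>Ob. inverse_morphisms C (T A I) A (runit C A) (runit_inv C A)) \<and>
     (\<forall>A\<in>Ob. \<forall>B\<in>Ob. inverse_morphisms C (T A B) (T B A) (symm C A B) (symm C B A)) \<and>
     (\<forall>A\<in>Ob. \<forall>B\<in>Ob. \<forall>D\<in>Ob. \<forall>A'\<in>Ob. \<forall>B'\<in>Ob. \<forall>D'\<in>Ob.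
        \<forall>\<phi>\<in>hom C A A'. \<forall>\<psi>\<in>hom C B B'. \<forall>\<theta>\<in>hom C D D'.
        assoc C A' B' D' \<circ> tmor C (T A B) D (T A' B') D' (tmor C A B A' B' \<phi> \<psi>) \<theta> =
        tmor C A (T B D) A' (T B' D') \<phi> (tmor C B D B' D' \<psi> \<theta>) \<circ> assoc C A B D) \<and>
     (\<forall>A\<in>Ob. \<forall>A'\<in>Ob. \<forall>\<phi>\<in>hom C A A'. lunit C A' \<circ> tmor C I A I A' (ident I) \<phi> = \<phi> \<circ> lunit C A) \<and>
     (\<forall>A\<in>Ob. \<forall>A'\<in>Ob. \<forall>\<phi>\<in>hom C A A'. runit C A' \<circ> tmor C A I A' I \<phi> (ident I) = \<phi> \<circ> runit C A) \<and>
     (\<forall>A\<in>Ob. \<forall>B\<in>Ob. \<forall>A'\<in>Ob. \<forall>B'\<in>Ob. \<forall>\<phi>\<in>hom C A A'. \<forall>\<psi>\<in>hom C B B'.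
        symm C A' B' \<circ> tmor C A B A' B' \<phi> \<psi> = tmor C B A B' A' \<psi> \<phi> \<circ> symm C A B) \<and>
     (\<forall>A\<in>Ob. \<forall>B\<in>Ob. \<forall>D\<in>Ob. \<forall>E\<in>Ob.
        assoc C A B (T D E) \<circ> assoc C (T A B) D E =
        tmor C A (T (T B D) E) A (T B (T D E)) (ident A) (assoc C B D E) \<circ> assoc C A (T B D) E \<circ>
        tmor C (T (T A B) D) E (T A (T B D)) E (assoc C A B D) (ident E)) \<and>
     (\<forall>A\<in>Ob. \<forall>B\<in>Ob.
        tmor C A (T I B) A B (ident A) (lunit C B) \<circ> assoc C A I B =
        tmor C (T A I) B A B (runit C A) (ident B)) \<and>
     (\<forall>A\<in>Ob. \<forall>B\<in>Ob. \<forall>D\<in>Ob.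
        assoc C B D A \<circ> symm C A (T B D) \<circ> assoc C A B D =
        tmor C B (T A D) B (T D A) (ident B) (symm C A D) \<circ> assoc C B A D \<circ>
        tmor C (T A B) D (T B A) D (symm C A B) (ident D)))"

definition monoidal_com_category :: "('v::real_normed_vector, 'z) com_cat_scheme \<Rightarrow> bool" where
  "monoidal_com_category C \<longleftrightarrow> com_category C \<and> symmetric_monoidal C \<and>
     (\<forall>A\<in>objs C. \<forall>B\<in>objs C. is_composite A B (tens C A B) (form C A B))"


section \<open>Self-duality\<close>

text \<open>
  States \<open>I \<rightarrow> A \<otimes> B\<close> and effects \<open>A \<otimes> B \<rightarrow> I\<close> are morphisms here. A vector of \<open>B\<close> is recovered from a
  morphism \<open>I \<rightarrow> B\<close> as its value at \<open>uvec C\<close>, a number from a vector of \<open>I\<close> by \<open>coord (uvec C)\<close>.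
\<close>

definition hat_state :: "('v::real_normed_vector, 'z) com_cat_scheme \<Rightarrow> 'v com \<Rightarrow> 'v com \<Rightarrow>
    ('v \<Rightarrow> 'v) \<Rightarrow> ('v \<Rightarrow> real) \<Rightarrow> 'v" where
  "hat_state C A B \<gamma> = (\<lambda>a. if a \<in> dual_space (vspace A)
     then (lunit C B \<circ> tmor C A B (unit_obj C) B (of_effect C a) (ident B) \<circ> \<gamma>) (uvec C) else 0)"

definition hat_effect :: "('v::real_normed_vector, 'z) com_cat_scheme \<Rightarrow> 'v com \<Rightarrow> 'v com \<Rightarrow>
    ('v \<Rightarrow> 'v) \<Rightarrow> 'v \<Rightarrow> 'v \<Rightarrow> real" where
  "hat_effect C A B f = (\<lambda>\<alpha> \<beta>. if \<alpha> \<in> vspace A \<and> \<beta> \<in> vspace B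
     then coord (uvec C) (f (tvec C A B \<alpha> \<beta>)) else 0)"

definition weakly_self_dual_structure :: "('v::real_normed_vector, 'z) com_cat_scheme \<Rightarrow>
    ('v com \<Rightarrow> 'v \<Rightarrow> 'v) \<Rightarrow> ('v com \<Rightarrow> 'v \<Rightarrow> 'v) \<Rightarrow> bool" where
  "weakly_self_dual_structure C \<gamma> f \<longleftrightarrow> (\<forall>A\<in>objs C.
     \<gamma> A \<in> hom C (unit_obj C) (tens C A A) \<and> f A \<in> hom C (tens C A A) (unit_obj C) \<and>
     order_isomorphism (dual_space (vspace A)) (eff A) (vspace A) (pos A) (hat_state C A A (\<gamma> A)) \<and>
     (\<forall>a\<in>dual_space (vspace A). hat_effect C A A (f A) (hat_state C A A (\<gamma> A) a) = a) \<and>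
     (\<forall>\<alpha>\<in>vspace A. hat_state C A A (\<gamma> A) (hat_effect C A A (f A) \<alpha>) = \<alpha>))"

definition symmetrically_self_dual_structure :: "('v::real_normed_vector, 'z) com_cat_scheme \<Rightarrow>
    ('v com \<Rightarrow> 'v \<Rightarrow> 'v) \<Rightarrow> ('v com \<Rightarrow> 'v \<Rightarrow> 'v) \<Rightarrow> bool" where
  "symmetrically_self_dual_structure C \<gamma> f \<longleftrightarrow> weakly_self_dual_structure C \<gamma> f \<and>
     (\<forall>A\<in>objs C. symm C A A \<circ> \<gamma> A = \<gamma> A)"

text \<open>
  \<open>1\<^sub>A \<otimes> \<sigma>\<^sub>B\<^sub>,\<^sub>D \<otimes> 1\<^sub>E\<close> with the associativity isomorphisms written out:
  \<open>(A \<otimes> B) \<otimes> (D \<otimes> E) \<rightarrow> (A \<otimes> D) \<otimes> (B \<otimes> E)\<close>.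
\<close>

definition middle_symm :: "('v::real_normed_vector, 'z) com_cat_scheme \<Rightarrow>
    'v com \<Rightarrow> 'v com \<Rightarrow> 'v com \<Rightarrow> 'v com \<Rightarrow> 'v \<Rightarrow> 'v" where
  "middle_symm C A B D E = (let T = tens C in
     assoc_inv C A D (T B E) \<circ>
     tmor C A (T (T D B) E) A (T D (T B E)) (ident A) (assoc C D B E) \<circ>
     tmor C A (T (T B D) E) A (T (T D B) E) (ident A)
       (tmor C (T B D) E (T D B) E (symm C B D) (ident E)) \<circ>
     tmor C A (T B (T D E)) A (T (T B D) E) (ident A) (assoc_inv C B D E) \<circ>
     assoc C A B (T D E))"

definition tensor_compatible :: "('v::real_normed_vector, 'z) com_cat_scheme \<Rightarrow>
    ('v com \<Rightarrow> 'v \<Rightarrow> 'v) \<Rightarrow> ('v com \<Rightarrow> 'v \<Rightarrow> 'v) \<Rightarrow> bool" where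
  "tensor_compatible C \<gamma> f \<longleftrightarrow> (let I = unit_obj C; T = tens C in
     \<gamma> I = lunit_inv C I \<and> f I = lunit C I \<and>
     (\<forall>A\<in>objs C. \<forall>B\<in>objs C.
        \<gamma> (T A B) = middle_symm C A A B B \<circ> tmor C I I (T A A) (T B B) (\<gamma> A) (\<gamma> B) \<circ> lunit_inv C I \<and>
        f (T A B) = lunit C I \<circ> tmor C (T A A) (T B B) I I (f A) (f B) \<circ> middle_symm C A B A B))"

text \<open>\<open>canonical_adjoint C \<gamma> f A B \<phi>\<close> is \<open>\<phi>'\<close> for \<open>\<phi> : A \<rightarrow> B\<close>.\<close>

definition canonical_adjoint :: "('v::real_normed_vector, 'z) com_cat_scheme \<Rightarrow>
    ('v com \<Rightarrow> 'v \<Rightarrow> 'v) \<Rightarrow> ('v com \<Rightarrow> 'v \<Rightarrow> 'v) \<Rightarrow> 'v com \<Rightarrow> 'v com \<Rightarrow> ('v \<Rightarrow> 'v) \<Rightarrow> 'v \<Rightarrow> 'v" where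
  "canonical_adjoint C \<gamma> f A B \<phi> = (let I = unit_obj C; T = tens C in
     runit C A \<circ>
     tmor C A (T B B) A I (ident A) (f B) \<circ>
     assoc C A B B \<circ>
     tmor C (T A A) B (T A B) B (tmor C A A A B (ident A) \<phi>) (ident B) \<circ>
     tmor C I B (T A A) B (\<gamma> A) (ident B) \<circ>
     lunit_inv C B)"


section \<open>Dagger compact categories\<close>

text \<open>
  In the following \<open>dag A B \<phi>\<close> is the dagger of \<open>\<phi> : A \<rightarrow> B\<close>, and \<open>(du A, \<eta> A, \<epsilon> A)\<close> is the chosen dual
  of \<open>A\<close>.
\<close>

definition is_dual :: "('v::real_normed_vector, 'z) com_cat_scheme \<Rightarrow> 'v com \<Rightarrow>
    'v com \<Rightarrow> ('v \<Rightarrow> 'v) \<Rightarrow> ('v \<Rightarrow> 'v) \<Rightarrow> bool" where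
  "is_dual C A A' \<eta> \<epsilon> \<longleftrightarrow> (let I = unit_obj C; T = tens C in
     A' \<in> objs C \<and> \<eta> \<in> hom C I (T A' A) \<and> \<epsilon> \<in> hom C (T A A') I \<and>
     lunit C A \<circ> tmor C (T A A') A I A \<epsilon> (ident A) \<circ> assoc_inv C A A' A \<circ>
       tmor C A I A (T A' A) (ident A) \<eta> \<circ> runit_inv C A = ident A \<and>
     runit C A' \<circ> tmor C A' (T A A') A' I (ident A') \<epsilon> \<circ> assoc C A' A A' \<circ>
       tmor C I A' (T A' A) A' \<eta> (ident A') \<circ> lunit_inv C A' = ident A')"

definition is_dagger :: "('v::real_normed_vector, 'z) com_cat_scheme \<Rightarrow>
    ('v com \<Rightarrow> 'v com \<Rightarrow> ('v \<Rightarrow> 'v) \<Rightarrow> 'v \<Rightarrow> 'v) \<Rightarrow> bool" where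
  "is_dagger C dag \<longleftrightarrow> (let Ob = objs C in
     (\<forall>A\<in>Ob. \<forall>B\<in>Ob. \<forall>\<phi>\<in>hom C A B. dag A B \<phi> \<in> hom C B A) \<and>
     (\<forall>A\<in>Ob. dag A A (ident A) = ident A) \<and>
     (\<forall>A\<in>Ob. \<forall>B\<in>Ob. \<forall>D\<in>Ob. \<forall>\<phi>\<in>hom C A B. \<forall>\<psi>\<in>hom C B D.
        dag A D (\<psi> \<circ> \<phi>) = dag A B \<phi> \<circ> dag B D \<psi>) \<and>
     (\<forall>A\<in>Ob. \<forall>B\<in>Ob. \<forall>\<phi>\<in>hom C A B. dag B A (dag A B \<phi>) = \<phi>))"

definition unitary :: "('v::real_normed_vector, 'z) com_cat_scheme \<Rightarrow>
    ('v com \<Rightarrow> 'v com \<Rightarrow> ('v \<Rightarrow> 'v) \<Rightarrow> 'v \<Rightarrow> 'v) \<Rightarrow> 'v com \<Rightarrow> 'v com \<Rightarrow> ('v \<Rightarrow> 'v) \<Rightarrow> bool" where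
  "unitary C dag A B \<phi> \<longleftrightarrow> inverse_morphisms C A B \<phi> (dag A B \<phi>)"

definition dagger_monoidal :: "('v::real_normed_vector, 'z) com_cat_scheme \<Rightarrow>
    ('v com \<Rightarrow> 'v com \<Rightarrow> ('v \<Rightarrow> 'v) \<Rightarrow> 'v \<Rightarrow> 'v) \<Rightarrow> bool" where
  "dagger_monoidal C dag \<longleftrightarrow> symmetric_monoidal C \<and> is_dagger C dag \<and>
     (let Ob = objs C; I = unit_obj C; T = tens C in
     (\<forall>A\<in>Ob. \<forall>B\<in>Ob. \<forall>D\<in>Ob. unitary C dag (T (T A B) D) (T A (T B D)) (assoc C A B D)) \<and>
     (\<forall>A\<in>Ob. unitary C dag (T I A) A (lunit C A)) \<and>
     (\<forall>A\<in>Ob. unitary C dag (T A I) A (runit C A)) \<and>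
     (\<forall>A\<in>Ob. \<forall>B\<in>Ob. unitary C dag (T A B) (T B A) (symm C A B)) \<and>
     (\<forall>A\<in>Ob. \<forall>B\<in>Ob. \<forall>A'\<in>Ob. \<forall>B'\<in>Ob. \<forall>\<phi>\<in>hom C A A'. \<forall>\<psi>\<in>hom C B B'.
        dag (T A B) (T A' B') (tmor C A B A' B' \<phi> \<psi>) = tmor C A' B' A B (dag A A' \<phi>) (dag B B' \<psi>)))"

definition dagger_compact :: "('v::real_normed_vector, 'z) com_cat_scheme \<Rightarrow>
    ('v com \<Rightarrow> 'v com \<Rightarrow> ('v \<Rightarrow> 'v) \<Rightarrow> 'v \<Rightarrow> 'v) \<Rightarrow> ('v com \<Rightarrow> 'v com) \<Rightarrow>
    ('v com \<Rightarrow> 'v \<Rightarrow> 'v) \<Rightarrow> ('v com \<Rightarrow> 'v \<Rightarrow> 'v) \<Rightarrow> bool" where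
  "dagger_compact C dag du \<eta> \<epsilon> \<longleftrightarrow> dagger_monoidal C dag \<and>
     (\<forall>A\<in>objs C. is_dual C A (du A) (\<eta> A) (\<epsilon> A)) \<and>
     (\<forall>A\<in>objs C. \<eta> A = symm C A (du A) \<circ> dag (tens C A (du A)) (unit_obj C) (\<epsilon> A))"

end

theory Submission
  imports Defs
begin

text \<open>
  The effect \<open>f\<^sub>A\<close> is a bilinear form \<open>\<langle>_, _\<rangle>\<^sub>A\<close> on \<open>A\<close>, and the two identities between \<open>\<gamma>\<^sub>A\<close> and \<open>f\<^sub>A\<close>
  say that, for any decomposition \<open>\<gamma>\<^sub>A = \<Sum>\<^sub>i x\<^sub>i \<otimes> y\<^sub>i\<close>,
  \<open>\<alpha> = \<Sum>\<^sub>i \<langle>\<alpha>, x\<^sub>i\<rangle> y\<^sub>i = \<Sum>\<^sub>i \<langle>y\<^sub>i, \<alpha>\<rangle> x\<^sub>i\<close>: the form is nondegenerate, these are the snake equations, and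
  symmetry of \<open>\<gamma>\<^sub>A\<close> passes to the form. The canonical adjoint is \<open>\<phi>' \<beta> = \<Sum>\<^sub>i \<langle>\<phi> y\<^sub>i, \<beta>\<rangle> x\<^sub>i\<close>, hence it is the adjoint
  with respect to these forms, \<open>\<langle>\<alpha>, \<phi>' \<beta>\<rangle>\<^sub>A = \<langle>\<phi> \<alpha>, \<beta>\<rangle>\<^sub>B\<close>, and it is determined by this. Since the form on
  \<open>A \<otimes> B\<close> is the product of those on \<open>A\<close> and \<open>B\<close>, the canonical isomorphisms are isometries, and every
  axiom is an identity between values of the forms on product vectors.
\<close>

section \<open>Linear maps and coordinates\<close>

lemma lin_mapsI:
  assumes "\<And>x. x \<in> V \<Longrightarrow> f x \<in> W"
    and "\<And>x y. x \<in> V \<Longrightarrow> y \<in> V \<Longrightarrow> f (x + y) = f x + f y"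
    and "\<And>c x. x \<in> V \<Longrightarrow> f (c *\<^sub>R x) = c *\<^sub>R f x"
    and "\<And>x. x \<notin> V \<Longrightarrow> f x = 0"
  shows "f \<in> lin_maps V W"
  using assms unfolding lin_maps_def by blast

lemma lin_maps_in: "f \<in> lin_maps V W \<Longrightarrow> x \<in> V \<Longrightarrow> f x \<in> W"
  and lin_maps_add: "f \<in> lin_maps V W \<Longrightarrow> x \<in> V \<Longrightarrow> y \<in> V \<Longrightarrow> f (x + y) = f x + f y"
  and lin_maps_scale: "f \<in> lin_maps V W \<Longrightarrow> x \<in> V \<Longrightarrow> f (c *\<^sub>R x) = c *\<^sub>R f x"
  and lin_maps_outside: "f \<in> lin_maps V W \<Longrightarrow> x \<notin> V \<Longrightarrow> f x = 0"
  unfolding lin_maps_def by blast+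

text \<open>Inside \<open>V\<close> the value at 0 comes from scaling by 0, outside \<open>V\<close>
  from the default value.\<close>

lemma lin_maps_zero: "f \<in> lin_maps V W \<Longrightarrow> f 0 = 0"
  using lin_maps_scale[of f V W 0 0] lin_maps_outside[of f V W 0] by (cases "0 \<in> V") auto

lemma lin_maps_diff:
  assumes "subspace V" "f \<in> lin_maps V W" "x \<in> V" "y \<in> V"
  shows "f (x - y) = f x - f y"
  using lin_maps_add[OF assms(2), of "x - y" y] subspace_diff[OF assms(1,3,4)] assms(4) by simp

lemma lin_maps_sum:
  assumes "subspace V" "f \<in> lin_maps V W" "\<And>i. i \<in> S \<Longrightarrow> x i \<in> V"
  shows "f (\<Sum>i\<in>S. x i) = (\<Sum>i\<in>S. f (x i))"
  using assms(3)
proof (induction S rule: infinite_finite_induct)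
  case (insert i S)
  then show ?case
    using lin_maps_add[OF assms(2), of "x i" "\<Sum>i\<in>S. x i"] subspace_sum[OF assms(1), of S x] by simp
qed (use lin_maps_zero[OF assms(2)] in auto)

lemma lin_maps_comp:
  assumes "f \<in> lin_maps U V" "g \<in> lin_maps V W"
  shows "g \<circ> f \<in> lin_maps U W"
  using assms lin_maps_zero[OF assms(2)]
  by (intro lin_mapsI) (simp_all add: lin_maps_in lin_maps_add lin_maps_scale lin_maps_outside)

lemma lin_maps_eqI:
  assumes "f \<in> lin_maps V W" "g \<in> lin_maps V W'" "\<And>x. x \<in> V \<Longrightarrow> f x = g x"
  shows "f = g"
  using assms(3) lin_maps_outside[OF assms(1)] lin_maps_outside[OF assms(2)] by fastforce

lemma sum_fun_apply: "(\<Sum>i\<in>S. f i) x = (\<Sum>i\<in>S. f i x)"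
  by (induction S rule: infinite_finite_induct) auto

lemma subspace_lin_maps: "subspace W \<Longrightarrow> subspace V \<Longrightarrow> subspace (lin_maps V W)"
  unfolding subspace_def[of "lin_maps V W"]
  by (auto intro!: lin_mapsI
      simp: lin_maps_in lin_maps_add lin_maps_scale lin_maps_outside scaleR_fun_def subspace_def algebra_simps)

lemma subspace_dual_space: "subspace V \<Longrightarrow> subspace (dual_space V)"
  by (simp add: dual_space_def subspace_lin_maps)

section \<open>Bases and dual bases\<close>

lemma findim_subspace: "findim_space V \<Longrightarrow> subspace V"
  by (simp add: findim_space_def)

lemma findim_basis:
  assumes "findim_space V"
  obtains B where "finite B" "independent B" "span B = V"
proof -
  from assms obtain B0 where "finite B0" "span B0 = V" by (auto simp: findim_space_def)
  then obtain B where "B \<subseteq> B0" "independent B" "B0 \<subseteq> span B"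
    using maximal_independent_subset[of B0] by metis
  then show thesis
    using that[of B] \<open>finite B0\<close> \<open>span B0 = V\<close>
    by (metis finite_subset span_mono span_span subset_antisym)
qed

text \<open>\<open>representation\<close> vanishes outside the span, in agreement with the default
  value of \<open>lin_maps\<close>, so the coordinates form the dual basis without being cut
  off.\<close>

lemma representation_in_dual:
  assumes "independent B" "span B = V"
  shows "(\<lambda>v. representation B v b) \<in> dual_space V"
  unfolding dual_space_def using assms
  by (intro lin_mapsI)
    (auto simp: representation_add representation_scale span_add span_scale, simp add: representation_def)

text \<open>Both sides vanish off \<open>V\<close>, so the expansion in the dual basis is an
  equation of total functions and can be substituted into a form on the dual space.\<close>

lemma dual_expand:
  assumes "finite B" "independent B" "span B = V" "a \<in> dual_space V"
  shows "a = (\<Sum>b\<in>B. a b *\<^sub>R (\<lambda>v. representation B v b))"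
proof
  fix v
  have sV: "subspace V" using assms(3) subspace_span by blast
  have a: "a \<in> lin_maps V UNIV" using assms(4) by (simp add: dual_space_def)
  have "a v = (\<Sum>b\<in>B. a b * representation B v b)"
  proof (cases "v \<in> V")
    case True
    have BV: "B \<subseteq> V" using assms(3) span_superset by blast
    have "a v = a (\<Sum>b\<in>B. representation B v b *\<^sub>R b)"
      using sum_representation_eq[OF assms(2) _ assms(1), of v] True assms(3) by simp
    also have "\<dots> = (\<Sum>b\<in>B. a (representation B v b *\<^sub>R b))"
      using BV by (intro lin_maps_sum[OF sV a]) (auto simp: subspace_scale[OF sV])
    also have "\<dots> = (\<Sum>b\<in>B. a b * representation B v b)"
      using BV by (intro sum.cong) (auto simp: lin_maps_scale[OF a])
    finally show ?thesis .
  next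
    case False
    then show ?thesis using lin_maps_outside[OF a] assms(3) by (simp add: representation_def)
  qed
  then show "a v = (\<Sum>b\<in>B. a b *\<^sub>R (\<lambda>v. representation B v b)) v"
    by (simp add: sum_fun_apply scaleR_fun_def)
qed

text \<open>The coordinate functionals of a basis are among the \<open>a\<close>, so the two vectors
  have the same coordinates.\<close>

lemma dual_separates:
  assumes "findim_space V" "x \<in> V" "y \<in> V" "\<And>a. a \<in> dual_space V \<Longrightarrow> a x = a y"
  shows "x = y"
proof -
  obtain B where B: "finite B" "independent B" "span B = V" using findim_basis[OF assms(1)] .
  have r: "representation B x b = representation B y b" for b
    by (rule assms(4)[OF representation_in_dual[OF B(2,3)]])
  have e: "(\<Sum>b\<in>B. representation B v b *\<^sub>R b) = v" if "v \<in> V" for v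
    using that B(3) by (intro sum_representation_eq[OF B(2) _ B(1)]) auto
  have "x = (\<Sum>b\<in>B. representation B x b *\<^sub>R b)" by (rule e[OF assms(2), symmetric])
  also have "\<dots> = (\<Sum>b\<in>B. representation B y b *\<^sub>R b)" unfolding r ..
  also have "\<dots> = y" by (rule e[OF assms(3)])
  finally show ?thesis .
qed

text \<open>One basis is fixed per subspace: \<open>lift\<close> then uses the same basis for every
  map, which makes it linear in that map.\<close>

definition basis :: "'a::real_vector set \<Rightarrow> 'a set" where
  "basis V = (SOME B. finite B \<and> independent B \<and> span B = V)"

lemma basis:
  assumes "findim_space V"
  shows "finite (basis V)" "independent (basis V)" "span (basis V) = V"
proof -
  have "\<exists>B. finite B \<and> independent B \<and> span B = V" using findim_basis[OF assms] by blast
  then have "finite (basis V) \<and> independent (basis V) \<and> span (basis V) = V"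
    unfolding basis_def by (rule someI_ex)
  then show "finite (basis V)" "independent (basis V)" "span (basis V) = V" by auto
qed

lemma basis_in: "findim_space V \<Longrightarrow> b \<in> basis V \<Longrightarrow> b \<in> V"
  using basis(3) span_base by blast

section \<open>Bilinear maps in coordinates\<close>

definition bilinear_on :: "'a::real_vector set \<Rightarrow> 'b::real_vector set \<Rightarrow> ('a \<Rightarrow> 'b \<Rightarrow> 'c::real_vector) \<Rightarrow> bool" where
  "bilinear_on V W g \<longleftrightarrow>
     (\<forall>x\<in>V. \<forall>x'\<in>V. \<forall>y\<in>W. g (x + x') y = g x y + g x' y) \<and> (\<forall>c. \<forall>x\<in>V. \<forall>y\<in>W. g (c *\<^sub>R x) y = c *\<^sub>R g x y) \<and>
     (\<forall>x\<in>V. \<forall>y\<in>W. \<forall>y'\<in>W. g x (y + y') = g x y + g x y') \<and> (\<forall>c. \<forall>x\<in>V. \<forall>y\<in>W. g x (c *\<^sub>R y) = c *\<^sub>R g x y)"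

lemma bilinear_on_expand:
  assumes "findim_space V" "findim_space W" "bilinear_on V W g" "x \<in> V" "y \<in> W"
  shows "g x y = (\<Sum>b\<in>basis V. \<Sum>c\<in>basis W. (representation (basis V) x b * representation (basis W) y c) *\<^sub>R g b c)"
proof -
  note V = basis[OF assms(1)] and W = basis[OF assms(2)]
  have sub: "subspace V" "subspace W" using assms(1,2) findim_subspace by auto
  note bi = assms(3)[unfolded bilinear_on_def]
  \<comment> \<open>The partial maps are cut off outside the subspaces, where
    \<open>bilinear_on\<close> says nothing and \<open>lin_maps\<close> demands 0.\<close>
  have l: "(\<lambda>x. if x \<in> V then g x y else 0) \<in> lin_maps V UNIV" if "y \<in> W" for y
    using that bi sub by (intro lin_mapsI) (auto simp: subspace_add subspace_scale)
  have r: "(\<lambda>y. if y \<in> W then g x y else 0) \<in> lin_maps W UNIV" if "x \<in> V" for x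
    using that bi sub by (intro lin_mapsI) (auto simp: subspace_add subspace_scale)
  have x: "x = (\<Sum>b\<in>basis V. representation (basis V) x b *\<^sub>R b)"
    using sum_representation_eq[OF V(2) _ V(1), of x] V(3) assms(4) by simp
  have y: "y = (\<Sum>b\<in>basis W. representation (basis W) y b *\<^sub>R b)"
    using sum_representation_eq[OF W(2) _ W(1), of y] W(3) assms(5) by simp
  have gx: "g x y = (\<Sum>b\<in>basis V. representation (basis V) x b *\<^sub>R g b y)"
    using lin_maps_sum[OF sub(1) l[OF assms(5)], of "basis V" "\<lambda>b. representation (basis V) x b *\<^sub>R b"]
      assms(4,5) x bi by (simp add: subspace_scale sub basis_in assms(1))
  have gy: "g b y = (\<Sum>c\<in>basis W. representation (basis W) y c *\<^sub>R g b c)" if "b \<in> V" for b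
    using lin_maps_sum[OF sub(2) r[OF that], of "basis W" "\<lambda>b. representation (basis W) y b *\<^sub>R b"]
      assms(5) that y bi by (simp add: subspace_scale sub basis_in assms(2))
  show ?thesis
    by (subst gx) (auto intro!: sum.cong simp: gy basis_in assms(1) scaleR_right.sum)
qed

section \<open>The coordinate on the line of scalars\<close>

lemma coord_scale: "e \<noteq> 0 \<Longrightarrow> coord e (t *\<^sub>R e) = t"
  by (auto simp: coord_def span_singleton intro!: the_equality)

lemma span_eq_coord: "e \<noteq> 0 \<Longrightarrow> x \<in> span {e} \<Longrightarrow> coord e x *\<^sub>R e = x"
  by (auto simp: span_singleton coord_scale)

lemma coord_dual: 
  assumes "e \<noteq> 0" shows "coord e \<in> dual_space (span {e})"
  unfolding dual_space_def
proof (rule lin_mapsI)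
  fix x y assume "x \<in> span {e}" "y \<in> span {e}"
  then obtain s t where [simp]: "x = s *\<^sub>R e" "y = t *\<^sub>R e" by (auto simp: span_singleton)
  show "coord e (x + y) = coord e x + coord e y"
    using coord_scale[OF assms, of "s + t"] by (simp add: coord_scale[OF assms] scaleR_add_left)
next
  fix c x assume "x \<in> span {e}"
  then obtain s where [simp]: "x = s *\<^sub>R e" by (auto simp: span_singleton)
  show "coord e (c *\<^sub>R x) = c *\<^sub>R coord e x"
    using coord_scale[OF assms, of "c * s"] by (simp add: coord_scale[OF assms])
qed (simp_all add: coord_def)

section \<open>Regular cones\<close>

lemma regular_cone_zero: "regular_cone V K \<Longrightarrow> 0 \<in> K"
  by (auto simp: regular_cone_def cone_def) (metis order_refl scaleR_zero_left)

lemma regular_cone_subset: "regular_cone V K \<Longrightarrow> K \<subseteq> V"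
proof
  fix x assume K: "regular_cone V K" and "x \<in> K"
  then have "x - 0 \<in> {x - y |x y. x \<in> K \<and> y \<in> K}" using regular_cone_zero[OF K] by blast
  then show "x \<in> V" using K unfolding regular_cone_def by simp
qed

lemma regular_cone_diff:
  assumes "regular_cone V K" "x \<in> V"
  obtains y z where "y \<in> K" "z \<in> K" "x = y - z"
  using assms unfolding regular_cone_def by blast

section \<open>Composites as tensor products\<close>

locale com_composite =
  fixes A B AB :: "'v::real_normed_vector com" and F
  assumes comA: "is_com A" and comB: "is_com B" and composite: "is_composite A B AB F"
begin

lemma com_AB: "is_com AB"
  and F_lin: "F \<in> lin_maps (vspace AB) (bilinear_forms (dual_space (vspace A)) (dual_space (vspace B)))"
  and F_inj: "inj_on F (vspace AB)"
  using composite by (auto simp: is_composite_def)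

lemma findim: "findim_space (vspace A)" "findim_space (vspace B)" "findim_space (vspace AB)"
  using comA comB com_AB by (auto simp: is_com_def)

lemma sub: "subspace (vspace A)" "subspace (vspace B)" "subspace (vspace AB)"
  using findim findim_subspace by auto

lemma reg: "regular_cone (vspace A) (pos A)" "regular_cone (vspace B) (pos B)"
    "regular_cone (vspace AB) (pos AB)"
  using comA comB com_AB by (auto simp: is_com_def)

lemma product_form_diff_left:
  "\<alpha> \<in> vspace A \<Longrightarrow> \<alpha>' \<in> vspace A \<Longrightarrow>
    product_form A B (\<alpha> - \<alpha>') \<beta> = product_form A B \<alpha> \<beta> - product_form A B \<alpha>' \<beta>"
  by (auto simp: product_form_def fun_eq_iff dual_space_def lin_maps_diff[OF sub(1)] algebra_simps)

lemma product_form_diff_right: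
  "\<beta> \<in> vspace B \<Longrightarrow> \<beta>' \<in> vspace B \<Longrightarrow>
    product_form A B \<alpha> (\<beta> - \<beta>') = product_form A B \<alpha> \<beta> - product_form A B \<alpha> \<beta>'"
  by (auto simp: product_form_def fun_eq_iff dual_space_def lin_maps_diff[OF sub(2)] algebra_simps)

text \<open>The axioms place product forms in the image only for vectors of the two cones. The cones
  generate, so \<open>\<alpha>\<close> and \<open>\<beta>\<close> are differences of such vectors,
  and the image of \<open>F\<close> is closed under differences.\<close>

lemma product_form_image:
  assumes "\<alpha> \<in> vspace A" "\<beta> \<in> vspace B"
  shows "product_form A B \<alpha> \<beta> \<in> F ` vspace AB"
proof -
  have d: "p - q \<in> F ` vspace AB" if pq: "p \<in> F ` vspace AB" "q \<in> F ` vspace AB" for p q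
  proof -
    obtain x y where "x \<in> vspace AB" "y \<in> vspace AB" "p = F x" "q = F y" using pq by blast
    then show ?thesis
      using lin_maps_diff[OF sub(3) F_lin, of x y] subspace_diff[OF sub(3)] by (metis image_eqI)
  qed
  have pp: "product_form A B a b \<in> F ` vspace AB" if "a \<in> pos A" "b \<in> pos B" for a b
    using that composite image_mono[OF regular_cone_subset[OF reg(3)], of F] unfolding is_composite_def by blast
  \<comment> \<open>The right vector is made arbitrary first, with the left one still in its
    cone.\<close>
  have pb: "product_form A B a \<beta> \<in> F ` vspace AB" if a: "a \<in> pos A" for a
  proof -
    obtain y z where yz: "y \<in> pos B" "z \<in> pos B" "\<beta> = y - z" using regular_cone_diff[OF reg(2) assms(2)] .
    then have "y \<in> vspace B" "z \<in> vspace B" using regular_cone_subset[OF reg(2)] by auto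
    then show ?thesis using d[OF pp[OF a yz(1)] pp[OF a yz(2)]] by (simp add: yz(3) product_form_diff_right)
  qed
  obtain y z where yz: "y \<in> pos A" "z \<in> pos A" "\<alpha> = y - z" using regular_cone_diff[OF reg(1) assms(1)] .
  then have "y \<in> vspace A" "z \<in> vspace A" using regular_cone_subset[OF reg(1)] by auto
  then show ?thesis using d[OF pb[OF yz(1)] pb[OF yz(2)]] by (simp add: yz(3) product_form_diff_left)
qed

section \<open>Product vectors and their bilinearity\<close>

definition tv :: "'v \<Rightarrow> 'v \<Rightarrow> 'v" where
  "tv \<alpha> \<beta> = inv_into (vspace AB) F (product_form A B \<alpha> \<beta>)"

lemma tv_in: "\<alpha> \<in> vspace A \<Longrightarrow> \<beta> \<in> vspace B \<Longrightarrow> tv \<alpha> \<beta> \<in> vspace AB"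
  and F_tv: "\<alpha> \<in> vspace A \<Longrightarrow> \<beta> \<in> vspace B \<Longrightarrow> F (tv \<alpha> \<beta>) = product_form A B \<alpha> \<beta>"
  using product_form_image[of \<alpha> \<beta>] by (auto simp: tv_def inv_into_into f_inv_into_f)

text \<open>\<open>F\<close> is injective, so bilinearity of product vectors is read off from the
  product forms.\<close>

lemma tv_add_left:
  assumes "\<alpha> \<in> vspace A" "\<alpha>' \<in> vspace A" "\<beta> \<in> vspace B"
  shows "tv (\<alpha> + \<alpha>') \<beta> = tv \<alpha> \<beta> + tv \<alpha>' \<beta>"
proof (rule inj_onD[OF F_inj])
  show "F (tv (\<alpha> + \<alpha>') \<beta>) = F (tv \<alpha> \<beta> + tv \<alpha>' \<beta>)"
    using assms by (auto simp: F_tv lin_maps_add[OF F_lin] tv_in subspace_add sub product_form_def fun_eq_iff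
      dual_space_def lin_maps_add algebra_simps)
qed (use assms in \<open>simp_all add: tv_in subspace_add sub\<close>)

lemma tv_add_right:
  assumes "\<alpha> \<in> vspace A" "\<beta>' \<in> vspace B" "\<beta> \<in> vspace B"
  shows "tv \<alpha> (\<beta> + \<beta>') = tv \<alpha> \<beta> + tv \<alpha> \<beta>'"
proof (rule inj_onD[OF F_inj])
  show "F (tv \<alpha> (\<beta> + \<beta>')) = F (tv \<alpha> \<beta> + tv \<alpha> \<beta>')"
    using assms by (auto simp: F_tv lin_maps_add[OF F_lin] tv_in subspace_add sub product_form_def fun_eq_iff
      dual_space_def lin_maps_add algebra_simps)
qed (use assms in \<open>simp_all add: tv_in subspace_add sub\<close>)

lemma tv_scale_left:
  assumes "\<alpha> \<in> vspace A" "\<beta> \<in> vspace B"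
  shows "tv (c *\<^sub>R \<alpha>) \<beta> = c *\<^sub>R tv \<alpha> \<beta>"
proof (rule inj_onD[OF F_inj])
  show "F (tv (c *\<^sub>R \<alpha>) \<beta>) = F (c *\<^sub>R tv \<alpha> \<beta>)"
    using assms by (auto simp: F_tv lin_maps_scale[OF F_lin] tv_in subspace_scale sub product_form_def fun_eq_iff
      dual_space_def lin_maps_scale scaleR_fun_def algebra_simps)
qed (use assms in \<open>simp_all add: tv_in subspace_scale sub\<close>)

lemma tv_scale_right:
  assumes "\<alpha> \<in> vspace A" "\<beta> \<in> vspace B"
  shows "tv \<alpha> (c *\<^sub>R \<beta>) = c *\<^sub>R tv \<alpha> \<beta>"
proof (rule inj_onD[OF F_inj])
  show "F (tv \<alpha> (c *\<^sub>R \<beta>)) = F (c *\<^sub>R tv \<alpha> \<beta>)"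
    using assms by (auto simp: F_tv lin_maps_scale[OF F_lin] tv_in subspace_scale sub product_form_def fun_eq_iff
      dual_space_def lin_maps_scale scaleR_fun_def algebra_simps)
qed (use assms in \<open>simp_all add: tv_in subspace_scale sub\<close>)

section \<open>Spanning by product vectors\<close>

lemma form_expand:
  assumes BA: "finite BA" "independent BA" "span BA = vspace A"
    and BB: "finite BB" "independent BB" "span BB = vspace B"
    and \<omega>: "\<omega> \<in> vspace AB"
    and p: "p \<in> dual_space (vspace A)" and q: "q \<in> dual_space (vspace B)"
  shows "F \<omega> p q = (\<Sum>b\<in>BA. \<Sum>c\<in>BB.
    p b * q c * F \<omega> (\<lambda>v. representation BA v b) (\<lambda>v. representation BB v c))"
proof -
  have F\<omega>: "F \<omega> \<in> lin_maps (dual_space (vspace A)) (dual_space (dual_space (vspace B)))"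
    using lin_maps_in[OF F_lin \<omega>] by (simp add: bilinear_forms_def)
  have F\<omega>a: "F \<omega> a \<in> lin_maps (dual_space (vspace B)) UNIV" if "a \<in> dual_space (vspace A)" for a
    using lin_maps_in[OF F\<omega> that] by (simp add: dual_space_def)
  note sA = subspace_dual_space[OF sub(1)] and sB = subspace_dual_space[OF sub(2)]
  note rA = representation_in_dual[OF BA(2,3)] and rB = representation_in_dual[OF BB(2,3)]
  have "F \<omega> p = (\<Sum>b\<in>BA. p b *\<^sub>R F \<omega> (\<lambda>v. representation BA v b))"
    by (subst dual_expand[OF BA p], subst lin_maps_sum[OF sA F\<omega>])
      (auto simp: subspace_scale[OF sA] rA lin_maps_scale[OF F\<omega>])
  moreover have "F \<omega> a q = (\<Sum>c\<in>BB. q c * F \<omega> a (\<lambda>v. representation BB v c))"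
    if "a \<in> dual_space (vspace A)" for a
    by (subst dual_expand[OF BB q], subst lin_maps_sum[OF sB F\<omega>a[OF that]])
      (auto simp: subspace_scale[OF sB] rB lin_maps_scale[OF F\<omega>a[OF that]])
  ultimately show ?thesis
    by (simp add: sum_fun_apply scaleR_fun_def rA sum_distrib_left mult.assoc)
qed

text \<open>A composite is no larger than the algebraic tensor product: a vector is known from its
  bilinear form, and the form from its values on pairs of dual basis vectors, which serve as the
  coefficients.\<close>

lemma tv_expand:
  assumes BA: "finite BA" "independent BA" "span BA = vspace A"
    and BB: "finite BB" "independent BB" "span BB = vspace B"
    and \<omega>: "\<omega> \<in> vspace AB"
  shows "\<omega> = (\<Sum>b\<in>BA. \<Sum>c\<in>BB.
    F \<omega> (\<lambda>v. representation BA v b) (\<lambda>v. representation BB v c) *\<^sub>R tv b c)" (is "_ = ?s")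
proof (rule inj_onD[OF F_inj _ \<omega>])
  have inA: "b \<in> vspace A" if "b \<in> BA" for b using that BA(3) span_base by blast
  have inB: "b \<in> vspace B" if "b \<in> BB" for b using that BB(3) span_base by blast
  have t: "r *\<^sub>R tv b c \<in> vspace AB" if "b \<in> BA" "c \<in> BB" for b c r
    using that by (simp add: tv_in inA inB subspace_scale sub)
  show "?s \<in> vspace AB" using t by (intro subspace_sum sub)
  have Fs: "F ?s = (\<Sum>b\<in>BA. \<Sum>c\<in>BB.
    F \<omega> (\<lambda>v. representation BA v b) (\<lambda>v. representation BB v c) *\<^sub>R product_form A B b c)"
    by (subst lin_maps_sum[OF sub(3) F_lin], use t in \<open>intro subspace_sum sub\<close>, assumption+, intro sum.cong refl,
      subst lin_maps_sum[OF sub(3) F_lin])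
      (auto simp: t lin_maps_scale[OF F_lin] tv_in F_tv inA inB)
  show "F \<omega> = F ?s"
  proof (intro ext)
    fix p q
    have F\<omega>: "F \<omega> \<in> lin_maps (dual_space (vspace A)) (dual_space (dual_space (vspace B)))"
      using lin_maps_in[OF F_lin \<omega>] by (simp add: bilinear_forms_def)
    show "F \<omega> p q = F ?s p q"
    proof (cases "p \<in> dual_space (vspace A) \<and> q \<in> dual_space (vspace B)")
      case True
      then show ?thesis
        unfolding Fs using form_expand[OF BA BB \<omega>, of p q]
        by (simp add: sum_fun_apply scaleR_fun_def product_form_def mult_ac)
    next
      case False
      \<comment> \<open>Off the dual spaces \<open>F \<omega>\<close> is 0 by the convention of
        \<open>lin_maps\<close>, and product forms are 0 by definition.\<close>
      have "F \<omega> p q = 0"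
      proof (cases "p \<in> dual_space (vspace A)")
        case True
        with False show ?thesis
          using lin_maps_in[OF F\<omega> True] lin_maps_outside[of "F \<omega> p"] by (auto simp: dual_space_def)
      next
        case False
        then show ?thesis using lin_maps_outside[OF F\<omega>] by simp
      qed
      then show ?thesis
        unfolding Fs using False by (auto simp: sum_fun_apply scaleR_fun_def product_form_def)
    qed
  qed
qed

lemma tensor_sum:
  assumes "\<omega> \<in> vspace AB"
  obtains S :: "('v \<times> 'v) set" and x y where "finite S"
    "\<And>i. x i \<in> vspace A" "\<And>i. y i \<in> vspace B" "\<omega> = (\<Sum>i\<in>S. tv (x i) (y i))"
proof -
  obtain BA where BA: "finite BA" "independent BA" "span BA = vspace A" using findim_basis[OF findim(1)] .
  obtain BB where BB: "finite BB" "independent BB" "span BB = vspace B" using findim_basis[OF findim(2)] .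
  have inA: "b \<in> vspace A" if "b \<in> BA" for b using that BA(3) span_base by blast
  have inB: "b \<in> vspace B" if "b \<in> BB" for b using that BB(3) span_base by blast
  let ?r = "\<lambda>i. F \<omega> (\<lambda>v. representation BA v (fst i)) (\<lambda>v. representation BB v (snd i))"
  \<comment> \<open>The coefficient is absorbed into the left factor. Both families are 0 off the
    index set, so that they lie in the spaces at every index.\<close>
  let ?x = "\<lambda>i. if i \<in> BA \<times> BB then ?r i *\<^sub>R fst i else 0"
  let ?y = "\<lambda>i. if i \<in> BA \<times> BB then snd i else 0"
  have "\<omega> = (\<Sum>b\<in>BA. \<Sum>c\<in>BB. ?r (b, c) *\<^sub>R tv b c)"
    using tv_expand[OF BA BB assms] by simp
  also have "\<dots> = (\<Sum>i\<in>BA \<times> BB. ?r i *\<^sub>R tv (fst i) (snd i))"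
    by (simp add: sum.cartesian_product case_prod_unfold)
  also have "\<dots> = (\<Sum>i\<in>BA \<times> BB. tv (?x i) (?y i))"
    by (intro sum.cong) (auto simp: tv_scale_left inA inB)
  finally show thesis
    by (intro that[of "BA \<times> BB" ?x ?y])
      (use BA(1) BB(1) in \<open>auto simp: inA inB subspace_scale sub subspace_0\<close>)
qed

text \<open>An explicit formula, so that the extension is visibly linear in \<open>g\<close>: trilinear maps are
  extended in two steps, and the first step has to stay linear in the third argument.\<close>

definition lift :: "('v \<Rightarrow> 'v \<Rightarrow> 'v) \<Rightarrow> 'v \<Rightarrow> 'v" where
  "lift g \<omega> = (if \<omega> \<in> vspace AB then \<Sum>b\<in>basis (vspace A). \<Sum>c\<in>basis (vspace B).
    F \<omega> (\<lambda>v. representation (basis (vspace A)) v b) (\<lambda>v. representation (basis (vspace B)) v c) *\<^sub>R g b c else 0)"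

lemma lift_lin:
  assumes "subspace X" "\<And>x y. x \<in> vspace A \<Longrightarrow> y \<in> vspace B \<Longrightarrow> g x y \<in> X"
  shows "lift g \<in> lin_maps (vspace AB) X"
proof (rule lin_mapsI)
  fix \<omega> assume "\<omega> \<in> vspace AB"
  then show "lift g \<omega> \<in> X"
    unfolding lift_def using assms(2) basis_in[OF findim(1)] basis_in[OF findim(2)]
    by (auto intro!: subspace_sum subspace_scale assms(1))
qed (simp_all add: lift_def lin_maps_add[OF F_lin] lin_maps_scale[OF F_lin] subspace_add subspace_scale sub
    scaleR_fun_def scaleR_add_left sum.distrib scaleR_right.sum)

text \<open>On a product vector the coefficients are the products of the coordinates of
  \<open>\<alpha>\<close> and \<open>\<beta>\<close>, so the sum is the basis expansion of
  \<open>g \<alpha> \<beta>\<close>.\<close>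

lemma lift_tv:
  assumes "bilinear_on (vspace A) (vspace B) g" "\<alpha> \<in> vspace A" "\<beta> \<in> vspace B"
  shows "lift g (tv \<alpha> \<beta>) = g \<alpha> \<beta>"
  using bilinear_on_expand[OF findim(1,2) assms] 
  by (simp add: lift_def F_tv tv_in assms product_form_def basis findim representation_in_dual)

lemma lift_add:
  assumes "\<And>x y. x \<in> vspace A \<Longrightarrow> y \<in> vspace B \<Longrightarrow> g x y = g' x y + g'' x y"
  shows "lift g \<omega> = lift g' \<omega> + lift g'' \<omega>"
  by (simp add: lift_def assms basis_in findim scaleR_add_right sum.distrib)

lemma lift_scale:
  assumes "\<And>x y. x \<in> vspace A \<Longrightarrow> y \<in> vspace B \<Longrightarrow> g x y = c *\<^sub>R g' x y"
  shows "lift g \<omega> = c *\<^sub>R lift g' \<omega>"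
  by (simp add: lift_def assms basis_in findim scaleR_right.sum mult.commute)

text \<open>There is no case for scalar multiples because a scalar can be moved into one factor of a
  product vector.\<close>

lemma tensor_induct [consumes 1, case_names tv add]:
  assumes \<omega>: "\<omega> \<in> vspace AB"
    and "\<And>\<alpha> \<beta>. \<alpha> \<in> vspace A \<Longrightarrow> \<beta> \<in> vspace B \<Longrightarrow> P (tv \<alpha> \<beta>)"
    and add: "\<And>x y. x \<in> vspace AB \<Longrightarrow> y \<in> vspace AB \<Longrightarrow> P x \<Longrightarrow> P y \<Longrightarrow> P (x + y)"
  shows "P \<omega>"
proof -
  obtain S x y where S: "finite (S :: ('v \<times> 'v) set)" "\<And>i. x i \<in> vspace A" "\<And>i. y i \<in> vspace B"
    "\<omega> = (\<Sum>i\<in>S. tv (x i) (y i))"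
    using tensor_sum[OF \<omega>] by metis
  have "0 \<in> vspace A" "0 \<in> vspace B" using sub subspace_0 by auto
  \<comment> \<open>Zero is itself a product vector, which settles the empty sum.\<close>
  moreover from this have "tv 0 0 = 0" using tv_scale_left[of 0 0 0] by simp
  ultimately have P0: "P 0" using assms(2)[of 0 0] by simp
  \<comment> \<open>Membership is carried along because the rule \<open>add\<close> asks for
    it.\<close>
  from S(1) have "P (\<Sum>i\<in>S. tv (x i) (y i)) \<and> (\<Sum>i\<in>S. tv (x i) (y i)) \<in> vspace AB"
  proof induction
    case empty show ?case using P0 subspace_0[OF sub(3)] by simp
  next
    case (insert i T)
    then show ?case using add[of "tv (x i) (y i)"] assms(2) S(2,3) by (simp add: tv_in subspace_add sub)
  qed
  with S(4) show ?thesis by simp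
qed

end

section \<open>Structural maps on product vectors\<close>

locale monoidal_coms =
  fixes C :: "'v::real_normed_vector com_cat"
  assumes monoidal: "monoidal_com_category C"
begin

section \<open>Axioms of the category, ready for resolution\<close>

abbreviation "Ob \<equiv> objs C"
abbreviation "I \<equiv> unit_obj C"
abbreviation "T \<equiv> tens C"
abbreviation "V \<equiv> vspace :: 'v com \<Rightarrow> 'v set"
abbreviation "tv \<equiv> tvec C"
abbreviation "u \<equiv> uvec C"

lemma category: "com_category C" and sym_monoidal: "symmetric_monoidal C"
  using monoidal by (auto simp: monoidal_com_category_def)

lemmas monoidal_conjuncts = sym_monoidal[unfolded symmetric_monoidal_def Let_def]

text \<open>In order: closure under tensor products, typing and the two functor laws of
  \<open>tmor\<close>, and the four families of canonical isomorphisms. They are cited below by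
  position.\<close>

lemmas monoidal_axioms =
  monoidal_conjuncts[THEN conjunct1]
  monoidal_conjuncts[THEN conjunct2, THEN conjunct1]
  monoidal_conjuncts[THEN conjunct2, THEN conjunct2, THEN conjunct1]
  monoidal_conjuncts[THEN conjunct2, THEN conjunct2, THEN conjunct2, THEN conjunct1]
  monoidal_conjuncts[THEN conjunct2, THEN conjunct2, THEN conjunct2, THEN conjunct2, THEN conjunct1]
  monoidal_conjuncts[THEN conjunct2, THEN conjunct2, THEN conjunct2, THEN conjunct2, THEN conjunct2, THEN conjunct1]
  monoidal_conjuncts[THEN conjunct2, THEN conjunct2, THEN conjunct2, THEN conjunct2, THEN conjunct2, THEN conjunct2, THEN conjunct1]
  monoidal_conjuncts[THEN conjunct2, THEN conjunct2, THEN conjunct2, THEN conjunct2, THEN conjunct2, THEN conjunct2, THEN conjunct2, THEN conjunct1]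

lemmas category_conjuncts = category[unfolded com_category_def]

lemmas category_axioms =
  category_conjuncts[THEN conjunct1]
  category_conjuncts[THEN conjunct2, THEN conjunct1]
  category_conjuncts[THEN conjunct2, THEN conjunct2, THEN conjunct1]
  category_conjuncts[THEN conjunct2, THEN conjunct2, THEN conjunct2, THEN conjunct1]
  category_conjuncts[THEN conjunct2, THEN conjunct2, THEN conjunct2, THEN conjunct2, THEN conjunct1]
  category_conjuncts[THEN conjunct2, THEN conjunct2, THEN conjunct2, THEN conjunct2, THEN conjunct2, THEN conjunct1]

lemma obj_com: "A \<in> Ob \<Longrightarrow> is_com A"
  and ident_hom: "A \<in> Ob \<Longrightarrow> ident A \<in> hom C A A"
  and hom_morphism: "A \<in> Ob \<Longrightarrow> B \<in> Ob \<Longrightarrow> \<phi> \<in> hom C A B \<Longrightarrow> \<phi> \<in> com_morphisms A B"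
  and u_nonzero: "u \<noteq> 0"
  and unit_obj: "I \<in> Ob"
  using category_axioms by blast+

text \<open>The hom-set premises come first so that resolution determines the middle object before its
  membership in the category has to be proved.\<close>

lemma comp_hom:
  assumes "\<psi> \<in> hom C B D" "\<phi> \<in> hom C A B" "A \<in> Ob" "B \<in> Ob" "D \<in> Ob"
  shows "\<psi> \<circ> \<phi> \<in> hom C A D"
  using category_axioms(3) assms by blast

lemma hom_lin: "A \<in> Ob \<Longrightarrow> B \<in> Ob \<Longrightarrow> \<phi> \<in> hom C A B \<Longrightarrow> \<phi> \<in> lin_maps (V A) (V B)"
  using hom_morphism by (auto simp: com_morphisms_def)

lemma tens_obj: "A \<in> Ob \<Longrightarrow> B \<in> Ob \<Longrightarrow> T A B \<in> Ob"
  using monoidal_axioms(1) by blast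

lemma tmor_hom:
  assumes "A \<in> Ob" "B \<in> Ob" "A' \<in> Ob" "B' \<in> Ob" "\<phi> \<in> hom C A A'" "\<psi> \<in> hom C B B'"
  shows "tmor C A B A' B' \<phi> \<psi> \<in> hom C (T A B) (T A' B')"
  using monoidal_axioms(2) assms by blast

lemma assoc_iso: "A \<in> Ob \<Longrightarrow> B \<in> Ob \<Longrightarrow> D \<in> Ob \<Longrightarrow>
    inverse_morphisms C (T (T A B) D) (T A (T B D)) (assoc C A B D) (assoc_inv C A B D)"
  using monoidal_axioms(5) by blast

lemma lunit_iso: "A \<in> Ob \<Longrightarrow> inverse_morphisms C (T I A) A (lunit C A) (lunit_inv C A)"
  using monoidal_axioms(6) by blast

lemma runit_iso: "A \<in> Ob \<Longrightarrow> inverse_morphisms C (T A I) A (runit C A) (runit_inv C A)"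
  using monoidal_axioms(7) by blast

lemma symm_iso: "A \<in> Ob \<Longrightarrow> B \<in> Ob \<Longrightarrow> inverse_morphisms C (T A B) (T B A) (symm C A B) (symm C B A)"
  using monoidal_axioms(8) by blast

text \<open>Collected so that long composites can be typed by resolution alone.\<close>

lemma structural_homs:
  shows "A \<in> Ob \<Longrightarrow> B \<in> Ob \<Longrightarrow> D \<in> Ob \<Longrightarrow> assoc C A B D \<in> hom C (T (T A B) D) (T A (T B D))"
    "A \<in> Ob \<Longrightarrow> B \<in> Ob \<Longrightarrow> D \<in> Ob \<Longrightarrow> assoc_inv C A B D \<in> hom C (T A (T B D)) (T (T A B) D)"
    "A \<in> Ob \<Longrightarrow> lunit C A \<in> hom C (T I A) A" "A \<in> Ob \<Longrightarrow> lunit_inv C A \<in> hom C A (T I A)"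
    "A \<in> Ob \<Longrightarrow> runit C A \<in> hom C (T A I) A" "A \<in> Ob \<Longrightarrow> runit_inv C A \<in> hom C A (T A I)"
    "A \<in> Ob \<Longrightarrow> B \<in> Ob \<Longrightarrow> symm C A B \<in> hom C (T A B) (T B A)"
    "A \<in> Ob \<Longrightarrow> ident A \<in> hom C A A"
  using assoc_iso lunit_iso runit_iso symm_iso ident_hom by (simp_all add: inverse_morphisms_def)

lemma ident_apply: "x \<in> V A \<Longrightarrow> ident A x = x"
  by (simp add: ident_def)

lemma obj_findim: "A \<in> Ob \<Longrightarrow> findim_space (V A)"
  using obj_com by (auto simp: is_com_def)

lemma obj_subspace: "A \<in> Ob \<Longrightarrow> subspace (V A)"
  using obj_findim findim_subspace by blast

lemma vspace_unit: "V I = span {u}"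
  by (simp add: unit_obj_def scalar_com_def)

lemma unit_in: "c *\<^sub>R u \<in> V I" "u \<in> V I"
  by (auto simp: vspace_unit span_base span_scale)

section \<open>Tensor product facts for objects of the category\<close>

lemma composite:
  assumes "A \<in> Ob" "B \<in> Ob"
  shows "com_composite A B (T A B) (form C A B)"
  using assms monoidal obj_com by unfold_locales (auto simp: monoidal_com_category_def)

text \<open>Both sides choose the preimage of the same product form, so that the results on
  composites speak about \<open>tvec\<close>.\<close>

lemma composite_tv:
  assumes "A \<in> Ob" "B \<in> Ob"
  shows "com_composite.tv A B (T A B) (form C A B) = tv A B"
  using com_composite.tv_def[OF composite[OF assms]] by (simp add: tvec_def fun_eq_iff)

lemma tv_in: "A \<in> Ob \<Longrightarrow> B \<in> Ob \<Longrightarrow> \<alpha> \<in> V A \<Longrightarrow> \<beta> \<in> V B \<Longrightarrow> tv A B \<alpha> \<beta> \<in> V (T A B)"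
  using com_composite.tv_in[OF composite, of A B] by (simp add: composite_tv)

lemma tv_bilinear: "A \<in> Ob \<Longrightarrow> B \<in> Ob \<Longrightarrow> bilinear_on (V A) (V B) (tv A B)"
  using com_composite.tv_add_left[OF composite, of A B] com_composite.tv_add_right[OF composite, of A B]
    com_composite.tv_scale_left[OF composite, of A B] com_composite.tv_scale_right[OF composite, of A B]
  by (simp add: composite_tv bilinear_on_def)

lemma tv_add_left: "A \<in> Ob \<Longrightarrow> B \<in> Ob \<Longrightarrow> \<alpha> \<in> V A \<Longrightarrow> \<alpha>' \<in> V A \<Longrightarrow> \<beta> \<in> V B \<Longrightarrow>
    tv A B (\<alpha> + \<alpha>') \<beta> = tv A B \<alpha> \<beta> + tv A B \<alpha>' \<beta>"
  and tv_scale_left: "A \<in> Ob \<Longrightarrow> B \<in> Ob \<Longrightarrow> \<alpha> \<in> V A \<Longrightarrow> \<beta> \<in> V B \<Longrightarrow>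
    tv A B (c *\<^sub>R \<alpha>) \<beta> = c *\<^sub>R tv A B \<alpha> \<beta>"
  and tv_add_right: "A \<in> Ob \<Longrightarrow> B \<in> Ob \<Longrightarrow> \<alpha> \<in> V A \<Longrightarrow> \<beta> \<in> V B \<Longrightarrow> \<beta>' \<in> V B \<Longrightarrow>
    tv A B \<alpha> (\<beta> + \<beta>') = tv A B \<alpha> \<beta> + tv A B \<alpha> \<beta>'"
  and tv_scale_right: "A \<in> Ob \<Longrightarrow> B \<in> Ob \<Longrightarrow> \<alpha> \<in> V A \<Longrightarrow> \<beta> \<in> V B \<Longrightarrow>
    tv A B \<alpha> (c *\<^sub>R \<beta>) = c *\<^sub>R tv A B \<alpha> \<beta>"
  using tv_bilinear[of A B] unfolding bilinear_on_def by blast+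

lemmas tv_linear = tv_add_left tv_scale_left tv_add_right tv_scale_right

lemma tensor_sum:
  assumes "A \<in> Ob" "B \<in> Ob" "\<omega> \<in> V (T A B)"
  obtains S :: "('v \<times> 'v) set" and x y where "finite S"
    "\<And>i. x i \<in> V A" "\<And>i. y i \<in> V B" "\<omega> = (\<Sum>i\<in>S. tv A B (x i) (y i))"
  using com_composite.tensor_sum[OF composite[OF assms(1,2)] assms(3)] composite_tv[OF assms(1,2)] by metis

lemma tensor_induct [consumes 3, case_names tv add]:
  assumes "A \<in> Ob" "B \<in> Ob" "\<omega> \<in> V (T A B)"
    and "\<And>\<alpha> \<beta>. \<alpha> \<in> V A \<Longrightarrow> \<beta> \<in> V B \<Longrightarrow> P (tv A B \<alpha> \<beta>)"
    and "\<And>x y. x \<in> V (T A B) \<Longrightarrow> y \<in> V (T A B) \<Longrightarrow> P x \<Longrightarrow> P y \<Longrightarrow> P (x + y)"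
  shows "P \<omega>"
  using com_composite.tensor_induct[OF composite[OF assms(1,2)] assms(3), of P] composite_tv[OF assms(1,2)] assms(4,5)
  by simp

section \<open>Universal property for two and three factors\<close>

lemma lin_maps_ext2:
  assumes "A \<in> Ob" "B \<in> Ob" "\<theta> \<in> lin_maps (V (T A B)) X" "\<theta>' \<in> lin_maps (V (T A B)) X'"
    and "\<And>\<alpha> \<beta>. \<alpha> \<in> V A \<Longrightarrow> \<beta> \<in> V B \<Longrightarrow> \<theta> (tv A B \<alpha> \<beta>) = \<theta>' (tv A B \<alpha> \<beta>)"
  shows "\<theta> = \<theta>'"
proof (rule lin_maps_eqI[OF assms(3,4)])
  fix x assume "x \<in> V (T A B)"
  with assms(1,2) show "\<theta> x = \<theta>' x"
    by (induction x rule: tensor_induct) (simp_all add: assms(5) lin_maps_add[OF assms(3)] lin_maps_add[OF assms(4)])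
qed

text \<open>For fixed \<open>\<delta>\<close> both sides are additive in the vector of
  \<open>T A B\<close>, so a second induction reduces that vector to a product vector.\<close>

lemma lin_maps_ext3:
  assumes "A \<in> Ob" "B \<in> Ob" "D \<in> Ob"
    and \<theta>: "\<theta> \<in> lin_maps (V (T (T A B) D)) X" "\<theta>' \<in> lin_maps (V (T (T A B) D)) X'"
    and eq: "\<And>\<alpha> \<beta> \<delta>. \<alpha> \<in> V A \<Longrightarrow> \<beta> \<in> V B \<Longrightarrow> \<delta> \<in> V D \<Longrightarrow>
      \<theta> (tv (T A B) D (tv A B \<alpha> \<beta>) \<delta>) = \<theta>' (tv (T A B) D (tv A B \<alpha> \<beta>) \<delta>)"
  shows "\<theta> = \<theta>'"
proof (rule lin_maps_ext2[OF tens_obj \<open>D \<in> Ob\<close> \<theta>])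
  fix \<omega> \<delta> assume "\<omega> \<in> V (T A B)" and d: "\<delta> \<in> V D"
  from \<open>A \<in> Ob\<close> \<open>B \<in> Ob\<close> this(1) show "\<theta> (tv (T A B) D \<omega> \<delta>) = \<theta>' (tv (T A B) D \<omega> \<delta>)"
    by (induction \<omega> rule: tensor_induct)
      (simp_all add: eq d tv_linear assms(1-3) tens_obj tv_in lin_maps_add[OF \<theta>(1)] lin_maps_add[OF \<theta>(2)])
qed fact+

lemma lin_maps_ext3':
  assumes "A \<in> Ob" "B \<in> Ob" "D \<in> Ob"
    and \<theta>: "\<theta> \<in> lin_maps (V (T A (T B D))) X" "\<theta>' \<in> lin_maps (V (T A (T B D))) X'"
    and eq: "\<And>\<alpha> \<beta> \<delta>. \<alpha> \<in> V A \<Longrightarrow> \<beta> \<in> V B \<Longrightarrow> \<delta> \<in> V D \<Longrightarrow>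
      \<theta> (tv A (T B D) \<alpha> (tv B D \<beta> \<delta>)) = \<theta>' (tv A (T B D) \<alpha> (tv B D \<beta> \<delta>))"
  shows "\<theta> = \<theta>'"
proof (rule lin_maps_ext2[OF \<open>A \<in> Ob\<close> tens_obj \<theta>])
  fix \<omega> \<alpha> assume "\<omega> \<in> V (T B D)" and d: "\<alpha> \<in> V A"
  from \<open>B \<in> Ob\<close> \<open>D \<in> Ob\<close> this(1) show "\<theta> (tv A (T B D) \<alpha> \<omega>) = \<theta>' (tv A (T B D) \<alpha> \<omega>)"
    by (induction \<omega> rule: tensor_induct)
      (simp_all add: eq d tv_linear assms(1-3) tens_obj tv_in lin_maps_add[OF \<theta>(1)] lin_maps_add[OF \<theta>(2)])
qed fact+

text \<open>The universal property of the tensor product, phrased by unique existence because the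
  structural maps are defined with \<open>THE\<close>.\<close>

lemma bilinear_extension:
  assumes "A \<in> Ob" "B \<in> Ob" "subspace (X :: 'v set)" "bilinear_on (V A) (V B) g"
    "\<And>x y. x \<in> V A \<Longrightarrow> y \<in> V B \<Longrightarrow> g x y \<in> X"
  shows "\<exists>!\<theta>. \<theta> \<in> lin_maps (V (T A B)) X \<and> (\<forall>\<alpha>\<in>V A. \<forall>\<beta>\<in>V B. \<theta> (tv A B \<alpha> \<beta>) = g \<alpha> \<beta>)"
proof (rule ex_ex1I)
  interpret c: com_composite A B "T A B" "form C A B" by (rule composite) fact+
  show "\<exists>\<theta>. \<theta> \<in> lin_maps (V (T A B)) X \<and> (\<forall>\<alpha>\<in>V A. \<forall>\<beta>\<in>V B. \<theta> (tv A B \<alpha> \<beta>) = g \<alpha> \<beta>)"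
    using c.lift_lin[OF assms(3), of g] c.lift_tv[OF assms(4)] assms(5) composite_tv[OF assms(1,2)] by auto
\<comment> \<open>What remains is uniqueness, the second half of \<open>ex_ex1I\<close>.\<close>
qed (elim conjE, rule lin_maps_ext2[OF assms(1,2)], assumption+, simp)

text \<open>With the third vector fixed, \<open>g\<close> extends to \<open>T A B\<close>. The
  extension depends linearly on that vector, so the result is bilinear and can be extended once
  more.\<close>

lemma trilinear_extension:
  assumes "A \<in> Ob" "B \<in> Ob" "D \<in> Ob" "subspace (X :: 'v set)"
    and in_X: "\<And>x y z. x \<in> V A \<Longrightarrow> y \<in> V B \<Longrightarrow> z \<in> V D \<Longrightarrow> g x y z \<in> X"
    and AB: "\<And>z. z \<in> V D \<Longrightarrow> bilinear_on (V A) (V B) (\<lambda>x y. g x y z)"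
    and BD: "\<And>x. x \<in> V A \<Longrightarrow> bilinear_on (V B) (V D) (\<lambda>y z. g x y z)"
  shows "\<exists>!\<theta>. \<theta> \<in> lin_maps (V (T (T A B) D)) X \<and>
    (\<forall>\<alpha>\<in>V A. \<forall>\<beta>\<in>V B. \<forall>\<delta>\<in>V D. \<theta> (tv (T A B) D (tv A B \<alpha> \<beta>) \<delta>) = g \<alpha> \<beta> \<delta>)"
proof (rule ex_ex1I)
  interpret c: com_composite A B "T A B" "form C A B" by (rule composite) fact+
  let ?h = "\<lambda>\<omega> z. c.lift (\<lambda>x y. g x y z) \<omega>"
  have l: "c.lift (\<lambda>x y. g x y z) \<in> lin_maps (V (T A B)) X" if "z \<in> V D" for z
    using that in_X by (intro c.lift_lin \<open>subspace X\<close>)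
  have "bilinear_on (V (T A B)) (V D) ?h"
    unfolding bilinear_on_def
  proof (intro conjI ballI allI)
    fix \<omega> z z' assume "\<omega> \<in> V (T A B)" "z \<in> V D" "z' \<in> V D"
    with BD show "?h \<omega> (z + z') = ?h \<omega> z + ?h \<omega> z'"
      by (intro c.lift_add) (auto simp: bilinear_on_def)
  next
    fix c \<omega> z assume "\<omega> \<in> V (T A B)" "z \<in> V D"
    with BD show "?h \<omega> (c *\<^sub>R z) = c *\<^sub>R ?h \<omega> z"
      by (intro c.lift_scale) (auto simp: bilinear_on_def)
  qed (simp_all add: lin_maps_add[OF l] lin_maps_scale[OF l])
  then have "\<exists>!\<theta>. \<theta> \<in> lin_maps (V (T (T A B) D)) X \<and>
      (\<forall>\<omega>\<in>V (T A B). \<forall>\<delta>\<in>V D. \<theta> (tv (T A B) D \<omega> \<delta>) = ?h \<omega> \<delta>)"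
    using assms(1-3) lin_maps_in[OF l] by (intro bilinear_extension tens_obj \<open>subspace X\<close>)
  then obtain \<theta> where \<theta>: "\<theta> \<in> lin_maps (V (T (T A B) D)) X"
      "\<forall>\<omega>\<in>V (T A B). \<forall>\<delta>\<in>V D. \<theta> (tv (T A B) D \<omega> \<delta>) = ?h \<omega> \<delta>"
    by (elim ex1E conjE) (rule that)
  show "\<exists>\<theta>. \<theta> \<in> lin_maps (V (T (T A B) D)) X \<and>
    (\<forall>\<alpha>\<in>V A. \<forall>\<beta>\<in>V B. \<forall>\<delta>\<in>V D. \<theta> (tv (T A B) D (tv A B \<alpha> \<beta>) \<delta>) = g \<alpha> \<beta> \<delta>)"
    using \<theta> tv_in[OF assms(1,2)] c.lift_tv[OF AB] composite_tv[OF assms(1,2)]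
    by (intro exI[of _ \<theta>]) simp
qed (elim conjE, rule lin_maps_ext3[OF assms(1-3)], assumption+, simp)

text \<open>The mirror image, with the first vector as the parameter; it serves
  \<open>assoc_inv\<close>.\<close>

lemma trilinear_extension':
  assumes "A \<in> Ob" "B \<in> Ob" "D \<in> Ob" "subspace (X :: 'v set)"
    and in_X: "\<And>x y z. x \<in> V A \<Longrightarrow> y \<in> V B \<Longrightarrow> z \<in> V D \<Longrightarrow> g x y z \<in> X"
    and AB: "\<And>z. z \<in> V D \<Longrightarrow> bilinear_on (V A) (V B) (\<lambda>x y. g x y z)"
    and BD: "\<And>x. x \<in> V A \<Longrightarrow> bilinear_on (V B) (V D) (\<lambda>y z. g x y z)"
  shows "\<exists>!\<theta>. \<theta> \<in> lin_maps (V (T A (T B D))) X \<and>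
    (\<forall>\<alpha>\<in>V A. \<forall>\<beta>\<in>V B. \<forall>\<delta>\<in>V D. \<theta> (tv A (T B D) \<alpha> (tv B D \<beta> \<delta>)) = g \<alpha> \<beta> \<delta>)"
proof (rule ex_ex1I)
  interpret c: com_composite B D "T B D" "form C B D" by (rule composite) fact+
  let ?h = "\<lambda>x \<omega>. c.lift (g x) \<omega>"
  have l: "c.lift (g x) \<in> lin_maps (V (T B D)) X" if "x \<in> V A" for x
    using that in_X by (intro c.lift_lin \<open>subspace X\<close>)
  have "bilinear_on (V A) (V (T B D)) ?h"
    unfolding bilinear_on_def
  proof (intro conjI ballI allI)
    fix \<omega> z z' assume "\<omega> \<in> V (T B D)" "z \<in> V A" "z' \<in> V A"
    with AB show "?h (z + z') \<omega> = ?h z \<omega> + ?h z' \<omega>"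
      by (intro c.lift_add) (auto simp: bilinear_on_def)
  next
    fix c \<omega> z assume "\<omega> \<in> V (T B D)" "z \<in> V A"
    with AB show "?h (c *\<^sub>R z) \<omega> = c *\<^sub>R ?h z \<omega>"
      by (intro c.lift_scale) (auto simp: bilinear_on_def)
  qed (simp_all add: lin_maps_add[OF l] lin_maps_scale[OF l])
  then have "\<exists>!\<theta>. \<theta> \<in> lin_maps (V (T A (T B D))) X \<and>
      (\<forall>\<alpha>\<in>V A. \<forall>\<omega>\<in>V (T B D). \<theta> (tv A (T B D) \<alpha> \<omega>) = ?h \<alpha> \<omega>)"
    using assms(1-3) lin_maps_in[OF l] by (intro bilinear_extension tens_obj \<open>subspace X\<close>)
  then obtain \<theta> where \<theta>: "\<theta> \<in> lin_maps (V (T A (T B D))) X"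
      "\<forall>\<alpha>\<in>V A. \<forall>\<omega>\<in>V (T B D). \<theta> (tv A (T B D) \<alpha> \<omega>) = ?h \<alpha> \<omega>"
    by (elim ex1E conjE) (rule that)
  show "\<exists>\<theta>. \<theta> \<in> lin_maps (V (T A (T B D))) X \<and>
    (\<forall>\<alpha>\<in>V A. \<forall>\<beta>\<in>V B. \<forall>\<delta>\<in>V D. \<theta> (tv A (T B D) \<alpha> (tv B D \<beta> \<delta>)) = g \<alpha> \<beta> \<delta>)"
    using \<theta> tv_in[OF assms(2,3)] c.lift_tv[OF BD] composite_tv[OF assms(2,3)]
    by (intro exI[of _ \<theta>]) simp
qed (elim conjE, rule lin_maps_ext3'[OF assms(1-3)], assumption+, simp)

section \<open>Evaluation of the structural maps\<close>

lemma tmor: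
  assumes "A \<in> Ob" "B \<in> Ob" "A' \<in> Ob" "B' \<in> Ob"
    and \<phi>: "\<phi> \<in> lin_maps (V A) (V A')" and \<psi>: "\<psi> \<in> lin_maps (V B) (V B')"
  shows tmor_lin: "tmor C A B A' B' \<phi> \<psi> \<in> lin_maps (V (T A B)) (V (T A' B'))"
    and tmor_tv: "\<And>\<alpha> \<beta>. \<alpha> \<in> V A \<Longrightarrow> \<beta> \<in> V B \<Longrightarrow>
      tmor C A B A' B' \<phi> \<psi> (tv A B \<alpha> \<beta>) = tv A' B' (\<phi> \<alpha>) (\<psi> \<beta>)"
proof -
  have "bilinear_on (V A) (V B) (\<lambda>\<alpha> \<beta>. tv A' B' (\<phi> \<alpha>) (\<psi> \<beta>))"
    unfolding bilinear_on_def
    using lin_maps_in[OF \<phi>] lin_maps_in[OF \<psi>] lin_maps_add[OF \<phi>] lin_maps_add[OF \<psi>]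
      lin_maps_scale[OF \<phi>] lin_maps_scale[OF \<psi>] tv_linear[OF assms(3,4)] by simp
  from theI'[OF bilinear_extension[OF assms(1,2) obj_subspace[OF tens_obj[OF assms(3,4)]] this]]
  show "tmor C A B A' B' \<phi> \<psi> \<in> lin_maps (V (T A B)) (V (T A' B'))"
    "\<And>\<alpha> \<beta>. \<alpha> \<in> V A \<Longrightarrow> \<beta> \<in> V B \<Longrightarrow>
      tmor C A B A' B' \<phi> \<psi> (tv A B \<alpha> \<beta>) = tv A' B' (\<phi> \<alpha>) (\<psi> \<beta>)"
    unfolding tmor_def using lin_maps_in[OF \<phi>] lin_maps_in[OF \<psi>] tv_in[OF assms(3,4)] by blast+
qed

lemma symm_tv:
  assumes "A \<in> Ob" "B \<in> Ob" "\<alpha> \<in> V A" "\<beta> \<in> V B"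
  shows "symm C A B (tv A B \<alpha> \<beta>) = tv B A \<beta> \<alpha>"
proof -
  have "bilinear_on (V A) (V B) (\<lambda>\<alpha> \<beta>. tv B A \<beta> \<alpha>)"
    unfolding bilinear_on_def using tv_linear[OF assms(2,1)] by simp
  from theI'[OF bilinear_extension[OF assms(1,2) obj_subspace[OF tens_obj[OF assms(2,1)]] this]]
  show ?thesis unfolding symm_def using tv_in[OF assms(2,1)] assms(3,4) by blast
qed

lemma assoc_tv:
  assumes "A \<in> Ob" "B \<in> Ob" "D \<in> Ob" "\<alpha> \<in> V A" "\<beta> \<in> V B" "\<delta> \<in> V D"
  shows "assoc C A B D (tv (T A B) D (tv A B \<alpha> \<beta>) \<delta>) = tv A (T B D) \<alpha> (tv B D \<beta> \<delta>)"
proof -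
  let ?g = "\<lambda>\<alpha> \<beta> \<delta>. tv A (T B D) \<alpha> (tv B D \<beta> \<delta>)"
  have "\<exists>!\<theta>. \<theta> \<in> lin_maps (V (T (T A B) D)) (V (T A (T B D))) \<and>
    (\<forall>\<alpha>\<in>V A. \<forall>\<beta>\<in>V B. \<forall>\<delta>\<in>V D. \<theta> (tv (T A B) D (tv A B \<alpha> \<beta>) \<delta>) = ?g \<alpha> \<beta> \<delta>)"
    using assms(1-3) by (intro trilinear_extension)
      (auto simp: bilinear_on_def tens_obj obj_subspace tv_in tv_linear)
  from theI'[OF this] show ?thesis unfolding assoc_def using assms(4-6) by blast
qed

lemma assoc_inv_tv:
  assumes "A \<in> Ob" "B \<in> Ob" "D \<in> Ob" "\<alpha> \<in> V A" "\<beta> \<in> V B" "\<delta> \<in> V D"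
  shows "assoc_inv C A B D (tv A (T B D) \<alpha> (tv B D \<beta> \<delta>)) = tv (T A B) D (tv A B \<alpha> \<beta>) \<delta>"
proof -
  let ?g = "\<lambda>\<alpha> \<beta> \<delta>. tv (T A B) D (tv A B \<alpha> \<beta>) \<delta>"
  have "\<exists>!\<theta>. \<theta> \<in> lin_maps (V (T A (T B D))) (V (T (T A B) D)) \<and>
    (\<forall>\<alpha>\<in>V A. \<forall>\<beta>\<in>V B. \<forall>\<delta>\<in>V D. \<theta> (tv A (T B D) \<alpha> (tv B D \<beta> \<delta>)) = ?g \<alpha> \<beta> \<delta>)"
    using assms(1-3) by (intro trilinear_extension')
      (auto simp: bilinear_on_def tens_obj obj_subspace tv_in tv_linear)
  from theI'[OF this] show ?thesis unfolding assoc_inv_def using assms(4-6) by blast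
qed

lemma coord_unit: "coord u (c *\<^sub>R u) = c" "coord u u = 1"
  using coord_scale[OF u_nonzero] coord_scale[OF u_nonzero, of 1] by auto

lemma coord_lin: "coord u \<in> lin_maps (V I) UNIV"
  using coord_dual[OF u_nonzero] by (simp add: dual_space_def vspace_unit)

lemma unit_eq: "x \<in> V I \<Longrightarrow> coord u x *\<^sub>R u = x"
  using span_eq_coord[OF u_nonzero] by (simp add: vspace_unit)

lemma lunit_tv:
  assumes "A \<in> Ob" "\<alpha> \<in> V A"
  shows "lunit C A (tv I A (c *\<^sub>R u) \<alpha>) = c *\<^sub>R \<alpha>"
proof -
  have "bilinear_on (V I) (V A) (\<lambda>x \<alpha>. coord u x *\<^sub>R \<alpha>)"
    by (simp add: bilinear_on_def lin_maps_add[OF coord_lin] lin_maps_scale[OF coord_lin] algebra_simps)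
  then have "\<exists>!\<theta>. \<theta> \<in> lin_maps (V (T I A)) (V A) \<and>
      (\<forall>x\<in>V I. \<forall>\<alpha>\<in>V A. \<theta> (tv I A x \<alpha>) = coord u x *\<^sub>R \<alpha>)"
    using assms(1) by (intro bilinear_extension) (auto simp: unit_obj obj_subspace subspace_scale)
  \<comment> \<open>The definition of \<open>lunit\<close> ranges over multiples of
    \<open>u\<close>, the extension over \<open>V I\<close>. The two agree since \<open>V I\<close>
    is the line through \<open>u\<close> and \<open>coord u\<close> reads off the multiple.\<close>
  moreover have "(\<forall>x\<in>V I. \<forall>\<alpha>\<in>V A. \<theta> (tv I A x \<alpha>) = coord u x *\<^sub>R \<alpha>) \<longleftrightarrow>
      (\<forall>t. \<forall>\<alpha>\<in>V A. \<theta> (tv I A (t *\<^sub>R u) \<alpha>) = t *\<^sub>R \<alpha>)" for \<theta>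
    by (metis coord_unit(1) unit_eq unit_in(1))
  ultimately have "\<exists>!\<theta>. \<theta> \<in> lin_maps (V (T I A)) (V A) \<and>
      (\<forall>t. \<forall>\<alpha>\<in>V A. \<theta> (tv I A (t *\<^sub>R u) \<alpha>) = t *\<^sub>R \<alpha>)" by simp
  from theI'[OF this] show ?thesis unfolding lunit_def using assms(2) by blast
qed

lemma runit_tv:
  assumes "A \<in> Ob" "\<alpha> \<in> V A"
  shows "runit C A (tv A I \<alpha> (c *\<^sub>R u)) = c *\<^sub>R \<alpha>"
proof -
  have "bilinear_on (V A) (V I) (\<lambda>\<alpha> x. coord u x *\<^sub>R \<alpha>)"
    by (simp add: bilinear_on_def lin_maps_add[OF coord_lin] lin_maps_scale[OF coord_lin] algebra_simps)
  then have "\<exists>!\<theta>. \<theta> \<in> lin_maps (V (T A I)) (V A) \<and>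
      (\<forall>\<alpha>\<in>V A. \<forall>x\<in>V I. \<theta> (tv A I \<alpha> x) = coord u x *\<^sub>R \<alpha>)"
    using assms(1) by (intro bilinear_extension) (auto simp: unit_obj obj_subspace subspace_scale)
  moreover have "(\<forall>\<alpha>\<in>V A. \<forall>x\<in>V I. \<theta> (tv A I \<alpha> x) = coord u x *\<^sub>R \<alpha>) \<longleftrightarrow>
      (\<forall>t. \<forall>\<alpha>\<in>V A. \<theta> (tv A I \<alpha> (t *\<^sub>R u)) = t *\<^sub>R \<alpha>)" for \<theta>
    by (metis coord_unit(1) unit_eq unit_in(1))
  ultimately have "\<exists>!\<theta>. \<theta> \<in> lin_maps (V (T A I)) (V A) \<and>
      (\<forall>t. \<forall>\<alpha>\<in>V A. \<theta> (tv A I \<alpha> (t *\<^sub>R u)) = t *\<^sub>R \<alpha>)" by simp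
  from theI'[OF this] show ?thesis unfolding runit_def using assms(2) by blast
qed

lemma tv_sum_left:
  assumes "A \<in> Ob" "B \<in> Ob" "\<And>i. i \<in> S \<Longrightarrow> x i \<in> V A" "\<beta> \<in> V B"
  shows "tv A B (\<Sum>i\<in>S. x i) \<beta> = (\<Sum>i\<in>S. tv A B (x i) \<beta>)"
proof -
  \<comment> \<open>The cut-off makes membership in \<open>lin_maps\<close> immediate, so that its
    sum rule applies.\<close>
  have "(\<lambda>\<alpha>. if \<alpha> \<in> V A then tv A B \<alpha> \<beta> else 0) \<in> lin_maps (V A) UNIV"
    using assms by (intro lin_mapsI) (simp_all add: tv_linear obj_subspace subspace_add subspace_scale)
  from lin_maps_sum[OF obj_subspace[OF assms(1)] this, of S x] show ?thesis
    using assms(3) subspace_sum[OF obj_subspace[OF assms(1)], of S x] by simp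
qed

lemma tv_sum_right:
  assumes "A \<in> Ob" "B \<in> Ob" "\<And>i. i \<in> S \<Longrightarrow> x i \<in> V B" "\<alpha> \<in> V A"
  shows "tv A B \<alpha> (\<Sum>i\<in>S. x i) = (\<Sum>i\<in>S. tv A B \<alpha> (x i))"
proof -
  have "(\<lambda>\<beta>. if \<beta> \<in> V B then tv A B \<alpha> \<beta> else 0) \<in> lin_maps (V B) UNIV"
    using assms by (intro lin_mapsI) (simp_all add: tv_linear obj_subspace subspace_add subspace_scale)
  from lin_maps_sum[OF obj_subspace[OF assms(2)] this, of S x] show ?thesis
    using assms(3) subspace_sum[OF obj_subspace[OF assms(2)], of S x] by simp
qed

text \<open>Every factor of the composite only rebrackets or swaps product vectors, so the exchange
  is computed factor by factor.\<close>

lemma middle_symm_tv: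
  assumes "A \<in> Ob" "B \<in> Ob" "D \<in> Ob" "E \<in> Ob" "a \<in> V A" "b \<in> V B" "d \<in> V D" "e \<in> V E"
  shows "middle_symm C A B D E (tv (T A B) (T D E) (tv A B a b) (tv D E d e)) =
    tv (T A D) (T B E) (tv A D a d) (tv B E b e)"
  using assms
  by (simp add: middle_symm_def Let_def assoc_tv assoc_inv_tv tmor_tv symm_tv tens_obj tv_in
    hom_lin structural_homs tmor_hom ident_apply)

end

section \<open>The bilinear form of a self-dual structure\<close>

locale self_dual_coms = monoidal_coms C for C :: "'v::real_normed_vector com_cat" +
  fixes \<gamma> f :: "'v com \<Rightarrow> 'v \<Rightarrow> 'v"
  assumes self_dual: "symmetrically_self_dual_structure C \<gamma> f"
    and compatible: "tensor_compatible C \<gamma> f"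
begin

lemma weak: "weakly_self_dual_structure C \<gamma> f"
  and gamma_symm: "A \<in> Ob \<Longrightarrow> symm C A A \<circ> \<gamma> A = \<gamma> A"
  using self_dual by (auto simp: symmetrically_self_dual_structure_def)

lemma gamma_hom: "A \<in> Ob \<Longrightarrow> \<gamma> A \<in> hom C I (T A A)"
  and f_hom: "A \<in> Ob \<Longrightarrow> f A \<in> hom C (T A A) I"
  and hat_lin: "A \<in> Ob \<Longrightarrow> hat_state C A A (\<gamma> A) \<in> lin_maps (dual_space (V A)) (V A)"
  and hat_fg: "A \<in> Ob \<Longrightarrow> a \<in> dual_space (V A) \<Longrightarrow> hat_effect C A A (f A) (hat_state C A A (\<gamma> A) a) = a"
  and hat_gf: "A \<in> Ob \<Longrightarrow> \<alpha> \<in> V A \<Longrightarrow> hat_state C A A (\<gamma> A) (hat_effect C A A (f A) \<alpha>) = \<alpha>"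
  using weak by (simp_all add: weakly_self_dual_structure_def order_isomorphism_def)

text \<open>This is \<open>hat_effect\<close> for \<open>f A\<close> without the cut-off outside
  \<open>V A\<close>.\<close>

definition bf :: "'v com \<Rightarrow> 'v \<Rightarrow> 'v \<Rightarrow> real" where
  "bf A \<alpha> \<beta> = coord u (f A (tv A A \<alpha> \<beta>))"

lemma f_lin: "A \<in> Ob \<Longrightarrow> coord u \<circ> f A \<in> lin_maps (V (T A A)) UNIV"
  using lin_maps_comp[OF hom_lin coord_lin] tens_obj unit_obj f_hom by blast

lemma bf_left_lin:
  assumes "A \<in> Ob" "\<beta> \<in> V A"
  shows "(\<lambda>\<alpha>. if \<alpha> \<in> V A then bf A \<alpha> \<beta> else 0) \<in> lin_maps (V A) UNIV"
  using assms lin_maps_add[OF f_lin[OF assms(1)]] lin_maps_scale[OF f_lin[OF assms(1)]]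
  by (intro lin_mapsI) (simp_all add: bf_def tv_linear tv_in obj_subspace subspace_add subspace_scale)

lemma bf_right_lin:
  assumes "A \<in> Ob" "\<alpha> \<in> V A"
  shows "(\<lambda>\<beta>. if \<beta> \<in> V A then bf A \<alpha> \<beta> else 0) \<in> lin_maps (V A) UNIV"
  using assms lin_maps_add[OF f_lin[OF assms(1)]] lin_maps_scale[OF f_lin[OF assms(1)]]
  by (intro lin_mapsI) (simp_all add: bf_def tv_linear tv_in obj_subspace subspace_add subspace_scale)

lemma bf_linear:
  assumes "A \<in> Ob" "\<alpha> \<in> V A" "\<beta> \<in> V A"
  shows "\<alpha>' \<in> V A \<Longrightarrow> bf A (\<alpha> + \<alpha>') \<beta> = bf A \<alpha> \<beta> + bf A \<alpha>' \<beta>" "bf A (c *\<^sub>R \<alpha>) \<beta> = c * bf A \<alpha> \<beta>"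
    "\<beta>' \<in> V A \<Longrightarrow> bf A \<alpha> (\<beta> + \<beta>') = bf A \<alpha> \<beta> + bf A \<alpha> \<beta>'" "bf A \<alpha> (c *\<^sub>R \<beta>) = c * bf A \<alpha> \<beta>"
  using assms lin_maps_add[OF f_lin[OF assms(1)]] lin_maps_scale[OF f_lin[OF assms(1)]]
  by (simp_all add: bf_def tv_linear tv_in)

lemma bf_sum_left:
  assumes "A \<in> Ob" "\<And>i. x i \<in> V A" "\<beta> \<in> V A"
  shows "bf A (\<Sum>i\<in>S. c i *\<^sub>R x i) \<beta> = (\<Sum>i\<in>S. c i * bf A (x i) \<beta>)"
  using lin_maps_sum[OF obj_subspace bf_left_lin, of A \<beta> S "\<lambda>i. c i *\<^sub>R x i"] assms
  by (simp add: obj_subspace subspace_sum subspace_scale bf_linear)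

lemma bf_sum_right:
  assumes "A \<in> Ob" "\<And>i. x i \<in> V A" "\<alpha> \<in> V A"
  shows "bf A \<alpha> (\<Sum>i\<in>S. c i *\<^sub>R x i) = (\<Sum>i\<in>S. c i * bf A \<alpha> (x i))"
  using lin_maps_sum[OF obj_subspace bf_right_lin, of A \<alpha> S "\<lambda>i. c i *\<^sub>R x i"] assms
  by (simp add: obj_subspace subspace_sum subspace_scale bf_linear)

lemma f_tv: "A \<in> Ob \<Longrightarrow> \<alpha> \<in> V A \<Longrightarrow> \<beta> \<in> V A \<Longrightarrow> f A (tv A A \<alpha> \<beta>) = bf A \<alpha> \<beta> *\<^sub>R u"
  unfolding bf_def
  by (rule unit_eq[symmetric]) (rule lin_maps_in[OF hom_lin[OF tens_obj unit_obj f_hom]], simp_all add: tv_in)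

section \<open>The curried form and decompositions of the state\<close>

lemma hat_effect_bf: "\<alpha> \<in> V A \<Longrightarrow> \<beta> \<in> V A \<Longrightarrow> hat_effect C A A (f A) \<alpha> \<beta> = bf A \<alpha> \<beta>"
  by (simp add: hat_effect_def bf_def)

text \<open>The default 0 of \<open>hat_effect\<close> outside \<open>V A\<close> is what makes the
  curried form a member of \<open>dual_space\<close>.\<close>

lemma hat_effect_dual: "A \<in> Ob \<Longrightarrow> \<alpha> \<in> V A \<Longrightarrow> hat_effect C A A (f A) \<alpha> \<in> dual_space (V A)"
  using bf_right_lin[of A \<alpha>] by (simp add: dual_space_def hat_effect_def bf_def cong: if_cong)

text \<open>Membership is required at every index, also outside \<open>S\<close>, so that it is
  available without a side condition when terms are rewritten under the sum.\<close>

definition decomposes :: "'v com \<Rightarrow> ('v \<times> 'v) set \<Rightarrow> ('v \<times> 'v \<Rightarrow> 'v) \<Rightarrow> ('v \<times> 'v \<Rightarrow> 'v) \<Rightarrow> bool" where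
  "decomposes A S x y \<longleftrightarrow> (\<forall>i. x i \<in> V A) \<and> (\<forall>i. y i \<in> V A) \<and> \<gamma> A u = (\<Sum>i\<in>S. tv A A (x i) (y i))"

lemma decomposesD:
  assumes "decomposes A S x y"
  shows "x i \<in> V A" "y i \<in> V A" "\<gamma> A u = (\<Sum>i\<in>S. tv A A (x i) (y i))"
  using assms unfolding decomposes_def by blast+

lemma decomposition:
  assumes "A \<in> Ob"
  obtains S x y where "decomposes A S x y"
proof -
  have "\<gamma> A u \<in> V (T A A)"
    using lin_maps_in[OF hom_lin[OF unit_obj tens_obj gamma_hom] unit_in(2)] assms by blast
  from tensor_sum[OF assms assms this] show thesis
    using that unfolding decomposes_def by metis
qed

text \<open>The swap of the factors fixes \<open>\<gamma> A\<close>. Through this lemma the symmetry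
  of the state reaches the form.\<close>

lemma decomposes_flip:
  assumes "A \<in> Ob" "decomposes A S x y"
  shows "decomposes A S y x"
proof -
  note d = decomposesD[OF assms(2)]
  have "\<gamma> A u = symm C A A (\<gamma> A u)" using gamma_symm[OF assms(1)] by (metis comp_apply)
  also have "\<dots> = (\<Sum>i\<in>S. symm C A A (tv A A (x i) (y i)))"
    unfolding d(3)
    by (rule lin_maps_sum[OF obj_subspace hom_lin[OF _ _ structural_homs(7)]])
      (use assms d in \<open>auto simp: tens_obj tv_in\<close>)
  also have "\<dots> = (\<Sum>i\<in>S. tv A A (y i) (x i))"
    using assms(1) d by (simp add: symm_tv)
  finally show ?thesis using d by (simp add: decomposes_def)
qed

text \<open>By linearity the functional is applied to the first factor of each term of the
  state.\<close>

lemma hat_state_sum: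
  assumes A: "A \<in> Ob" and "decomposes A S x y" and a: "a \<in> dual_space (V A)"
  shows "hat_state C A A (\<gamma> A) a = (\<Sum>i\<in>S. a (x i) *\<^sub>R y i)"
proof -
  note d = decomposesD[OF assms(2)]
  have a': "a \<in> lin_maps (V A) UNIV" using a by (simp add: dual_space_def)
  \<comment> \<open>The functional \<open>a\<close> may lie outside \<open>eff A\<close>, so
    \<open>of_effect C a\<close> is shown to be linear rather than a morphism; linearity is what
    \<open>tmor_tv\<close> asks for.\<close>
  have oe: "of_effect C a \<in> lin_maps (V A) (V I)"
    by (rule lin_mapsI)
      (simp_all add: of_effect_def unit_in lin_maps_add[OF a'] lin_maps_scale[OF a'] lin_maps_outside[OF a'] scaleR_add_left)
  let ?m = "lunit C A \<circ> tmor C A A I A (of_effect C a) (ident A)"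
  have lin: "?m \<in> lin_maps (V (T A A)) (V A)"
    by (rule lin_maps_comp[OF tmor_lin hom_lin[OF _ _ structural_homs(3)]])
      (use A oe in \<open>auto simp: unit_obj tens_obj hom_lin ident_hom\<close>)
  have "hat_state C A A (\<gamma> A) a = ?m (\<Sum>i\<in>S. tv A A (x i) (y i))"
    using a d(3) by (simp add: hat_state_def)
  also have "\<dots> = (\<Sum>i\<in>S. ?m (tv A A (x i) (y i)))"
    by (rule lin_maps_sum[OF obj_subspace lin]) (use A d in \<open>auto simp: tens_obj tv_in\<close>)
  also have "\<dots> = (\<Sum>i\<in>S. a (x i) *\<^sub>R y i)"
    using A d oe by (simp add: tmor_tv unit_obj hom_lin ident_hom ident_apply lunit_tv of_effect_def)
  finally show ?thesis .
qed

text \<open>This is \<open>hat_gf\<close> at \<open>\<alpha>\<close>, with the functional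
  \<open>hat_effect C A A (f A) \<alpha>\<close> put into the formula for
  \<open>hat_state\<close>.\<close>

lemma expand_right:
  assumes "A \<in> Ob" "decomposes A S x y" "\<alpha> \<in> V A"
  shows "(\<Sum>i\<in>S. bf A \<alpha> (x i) *\<^sub>R y i) = \<alpha>"
  using hat_state_sum[OF assms(1,2) hat_effect_dual[OF assms(1,3)]] hat_gf[OF assms(1,3)]
    decomposesD[OF assms(2)] assms(3) by (simp add: hat_effect_bf)

text \<open>The other identity, \<open>hat_fg\<close>, lives in the dual space. Both sides are
  therefore tested against a functional \<open>a\<close>, which turns the sum into the form at
  \<open>hat_state C A A (\<gamma> A) a\<close> and \<open>\<beta>\<close>.\<close>

lemma expand_left:
  assumes A: "A \<in> Ob" and dec: "decomposes A S x y" and \<beta>: "\<beta> \<in> V A"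
  shows "(\<Sum>i\<in>S. bf A (y i) \<beta> *\<^sub>R x i) = \<beta>"
proof (rule dual_separates[OF obj_findim[OF A] _ \<beta>])
  note d = decomposesD[OF dec]
  show "(\<Sum>i\<in>S. bf A (y i) \<beta> *\<^sub>R x i) \<in> V A"
    using d by (intro subspace_sum subspace_scale obj_subspace A)
  fix a assume a: "a \<in> dual_space (V A)"
  then have a': "a \<in> lin_maps (V A) UNIV" by (simp add: dual_space_def)
  have "a (\<Sum>i\<in>S. bf A (y i) \<beta> *\<^sub>R x i) = (\<Sum>i\<in>S. a (x i) * bf A (y i) \<beta>)"
    using lin_maps_sum[OF obj_subspace[OF A] a', of S "\<lambda>i. bf A (y i) \<beta> *\<^sub>R x i"] d
    by (simp add: subspace_scale obj_subspace A lin_maps_scale[OF a'] mult.commute)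
  also have "\<dots> = bf A (hat_state C A A (\<gamma> A) a) \<beta>"
    using d \<beta> by (simp add: hat_state_sum[OF A dec a] bf_sum_left[OF A])
  also have "\<dots> = a \<beta>"
    using hat_effect_bf[OF lin_maps_in[OF hat_lin[OF A] a] \<beta>] hat_fg[OF A a] by simp
  finally show "a (\<Sum>i\<in>S. bf A (y i) \<beta> *\<^sub>R x i) = a \<beta>" .
qed

text \<open>Expanding the first argument by a decomposition for one order and by the flipped
  decomposition for the other gives the same sum of terms
  \<open>bf A (y i) \<alpha> * bf A (x i) \<beta>\<close>.\<close>

lemma bf_commute:
  assumes A: "A \<in> Ob" and "\<alpha> \<in> V A" "\<beta> \<in> V A"
  shows "bf A \<alpha> \<beta> = bf A \<beta> \<alpha>"
proof -
  obtain S x y where dec: "decomposes A S x y" using decomposition[OF A] .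
  note d = decomposesD[OF dec]
  have "bf A \<alpha> \<beta> = (\<Sum>i\<in>S. bf A (y i) \<alpha> * bf A (x i) \<beta>)"
    using expand_left[OF A dec assms(2)] bf_sum_left[OF A _ assms(3), of x, where S = S and c = "\<lambda>i. bf A (y i) \<alpha>"] d by simp
  also have "\<dots> = (\<Sum>i\<in>S. bf A (x i) \<beta> * bf A (y i) \<alpha>)" by (simp add: mult.commute)
  also have "\<dots> = bf A \<beta> \<alpha>"
    using expand_left[OF A decomposes_flip[OF A dec] assms(3)]
      bf_sum_left[OF A _ assms(2), of y, where S = S and c = "\<lambda>i. bf A (x i) \<beta>"] d by simp
  finally show ?thesis .
qed

text \<open>By \<open>expand_left\<close> a vector is recovered from the numbers
  \<open>bf A (y i) \<beta>\<close>.\<close>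

lemma bf_nondegenerate:
  assumes A: "A \<in> Ob" and "\<beta> \<in> V A" "\<beta>' \<in> V A" "\<And>\<alpha>. \<alpha> \<in> V A \<Longrightarrow> bf A \<alpha> \<beta> = bf A \<alpha> \<beta>'"
  shows "\<beta> = \<beta>'"
proof -
  obtain S x y where dec: "decomposes A S x y" using decomposition[OF A] .
  have "\<beta> = (\<Sum>i\<in>S. bf A (y i) \<beta> *\<^sub>R x i)" using expand_left[OF A dec assms(2)] by simp
  also have "\<dots> = (\<Sum>i\<in>S. bf A (y i) \<beta>' *\<^sub>R x i)" using assms(4) decomposesD[OF dec] by simp
  also have "\<dots> = \<beta>'" using expand_left[OF A dec assms(3)] by simp
  finally show ?thesis .
qed

section \<open>The canonical adjoint\<close>

abbreviation adj :: "'v com \<Rightarrow> 'v com \<Rightarrow> ('v \<Rightarrow> 'v) \<Rightarrow> 'v \<Rightarrow> 'v" where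
  "adj \<equiv> canonical_adjoint C \<gamma> f"

lemma adj_hom:
  assumes "A \<in> Ob" "B \<in> Ob" "\<phi> \<in> hom C A B"
  shows "adj A B \<phi> \<in> hom C B A"
  unfolding canonical_adjoint_def Let_def
  by (rule comp_hom tmor_hom structural_homs tens_obj unit_obj gamma_hom f_hom assms)+

text \<open>Inserting a decomposition of the state turns the diagram into a finite sum, from which
  the adjoint relation is derived.\<close>

lemma adj_apply:
  assumes A: "A \<in> Ob" and B: "B \<in> Ob" and \<phi>: "\<phi> \<in> hom C A B" and dec: "decomposes A S x y" and \<beta>: "\<beta> \<in> V B"
  shows "adj A B \<phi> \<beta> = (\<Sum>i\<in>S. bf B (\<phi> (y i)) \<beta> *\<^sub>R x i)"
proof -
  note d = decomposesD[OF dec]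
  have \<phi>V: "\<phi> z \<in> V B" if "z \<in> V A" for z using lin_maps_in[OF hom_lin[OF A B \<phi>] that] .
  \<comment> \<open>This is the part of the diagram after the insertion of the state; its linearity
    lets the sum be taken out.\<close>
  let ?m = "runit C A \<circ> tmor C A (T B B) A I (ident A) (f B) \<circ> assoc C A B B \<circ>
    tmor C (T A A) B (T A B) B (tmor C A A A B (ident A) \<phi>) (ident B)"
  have "?m \<in> hom C (T (T A A) B) A"
    by (rule comp_hom tmor_hom structural_homs tens_obj unit_obj gamma_hom f_hom A B \<phi>)+
  then have lin: "?m \<in> lin_maps (V (T (T A A) B)) (V A)"
    by (intro hom_lin tens_obj A B)
  \<comment> \<open>\<open>lunit_inv\<close> sends \<open>\<beta>\<close> to the product of
    \<open>u\<close> and \<open>\<beta>\<close>, and the state acts on \<open>u\<close>.\<close>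
  have "adj A B \<phi> \<beta> = ?m (tv (T A A) B (\<gamma> A u) \<beta>)"
    using A B \<beta> by (simp add: canonical_adjoint_def Let_def lunit_inv_def tmor_tv unit_in unit_obj tens_obj hom_lin
      gamma_hom ident_hom ident_apply)
  also have "\<dots> = ?m (\<Sum>i\<in>S. tv (T A A) B (tv A A (x i) (y i)) \<beta>)"
    unfolding d(3) using A B \<beta> d by (simp add: tv_sum_left tens_obj tv_in)
  also have "\<dots> = (\<Sum>i\<in>S. ?m (tv (T A A) B (tv A A (x i) (y i)) \<beta>))"
    by (rule lin_maps_sum[OF obj_subspace lin]) (use A B \<beta> d in \<open>auto simp: tens_obj tv_in\<close>)
  also have "\<dots> = (\<Sum>i\<in>S. bf B (\<phi> (y i)) \<beta> *\<^sub>R x i)"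
    using A B \<beta> d \<phi> \<phi>V by (simp add: tmor_tv tens_obj hom_lin tmor_hom ident_hom ident_apply assoc_tv tv_in unit_obj
      f_hom f_tv runit_tv)
  finally show ?thesis .
qed

text \<open>Pairing the sum for the adjoint with \<open>\<alpha>\<close> and moving the coefficients
  \<open>bf A \<alpha> (x i)\<close> into the first argument of \<open>bf B\<close> leaves
  \<open>\<phi>\<close> applied to an expansion of \<open>\<alpha>\<close>.\<close>

lemma bf_adj:
  assumes A: "A \<in> Ob" and B: "B \<in> Ob" and \<phi>: "\<phi> \<in> hom C A B" and "\<alpha> \<in> V A" "\<beta> \<in> V B"
  shows "bf A \<alpha> (adj A B \<phi> \<beta>) = bf B (\<phi> \<alpha>) \<beta>"
proof -
  obtain S x y where dec: "decomposes A S x y" using decomposition[OF A] .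
  note d = decomposesD[OF dec]
  note lin = hom_lin[OF A B \<phi>]
  have "bf A \<alpha> (adj A B \<phi> \<beta>) = (\<Sum>i\<in>S. bf B (\<phi> (y i)) \<beta> * bf A \<alpha> (x i))"
    using d assms by (simp add: adj_apply[OF A B \<phi> dec] bf_sum_right)
  also have "\<dots> = (\<Sum>i\<in>S. bf A \<alpha> (x i) * bf B (\<phi> (y i)) \<beta>)" by (simp add: mult.commute)
  also have "\<dots> = bf B (\<Sum>i\<in>S. bf A \<alpha> (x i) *\<^sub>R \<phi> (y i)) \<beta>"
    using d assms lin_maps_in[OF lin] by (simp add: bf_sum_left)
  also have "(\<Sum>i\<in>S. bf A \<alpha> (x i) *\<^sub>R \<phi> (y i)) = \<phi> (\<Sum>i\<in>S. bf A \<alpha> (x i) *\<^sub>R y i)"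
    using lin_maps_sum[OF obj_subspace[OF A] lin, of S "\<lambda>i. bf A \<alpha> (x i) *\<^sub>R y i"] d
    by (simp add: subspace_scale obj_subspace A lin_maps_scale[OF lin])
  also have "\<dots> = \<phi> \<alpha>" using expand_right[OF A dec assms(4)] by simp
  finally show ?thesis .
qed

text \<open>Nondegeneracy of the form on \<open>A\<close> leaves at most one map with the adjoint
  relation.\<close>

lemma adj_unique:
  assumes A: "A \<in> Ob" and B: "B \<in> Ob" and \<phi>: "\<phi> \<in> hom C A B" and \<psi>: "\<psi> \<in> hom C B A"
    and eq: "\<And>\<alpha> \<beta>. \<alpha> \<in> V A \<Longrightarrow> \<beta> \<in> V B \<Longrightarrow> bf B (\<phi> \<alpha>) \<beta> = bf A \<alpha> (\<psi> \<beta>)"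
  shows "adj A B \<phi> = \<psi>"
proof (rule lin_maps_eqI)
  show l: "adj A B \<phi> \<in> lin_maps (V B) (V A)" "\<psi> \<in> lin_maps (V B) (V A)"
    using hom_lin[OF B A] \<psi> adj_hom[OF A B \<phi>] by auto
  fix \<beta> assume \<beta>: "\<beta> \<in> V B"
  show "adj A B \<phi> \<beta> = \<psi> \<beta>"
    by (rule bf_nondegenerate[OF A lin_maps_in[OF l(1) \<beta>] lin_maps_in[OF l(2) \<beta>]])
      (simp add: bf_adj[OF A B \<phi> _ \<beta>] eq \<beta>)
qed

text \<open>Since \<open>\<beta>\<close> is \<open>\<phi> (\<psi> \<beta>)\<close>, an isometry
  pairs \<open>\<phi> \<alpha>\<close> with \<open>\<beta>\<close> as \<open>\<alpha>\<close> with
  \<open>\<psi> \<beta>\<close>, so the inverse satisfies the adjoint relation.\<close>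

lemma adj_inverse:
  assumes A: "A \<in> Ob" and B: "B \<in> Ob" and inv: "inverse_morphisms C A B \<phi> \<psi>"
    and eq: "\<And>x y. x \<in> V A \<Longrightarrow> y \<in> V A \<Longrightarrow> bf B (\<phi> x) (\<phi> y) = bf A x y"
  shows "unitary C adj A B \<phi>"
proof -
  have "\<phi> \<in> hom C A B" "\<psi> \<in> hom C B A" and c: "\<phi> \<circ> \<psi> = ident B"
    using inv by (auto simp: inverse_morphisms_def)
  moreover have "bf B (\<phi> \<alpha>) \<beta> = bf A \<alpha> (\<psi> \<beta>)" if "\<alpha> \<in> V A" "\<beta> \<in> V B" for \<alpha> \<beta>
    using eq[OF that(1) lin_maps_in[OF hom_lin[OF B A \<open>\<psi> \<in> hom C B A\<close>] that(2)]] fun_cong[OF c, of \<beta>] that(2)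
    by (simp add: ident_apply)
  ultimately have "adj A B \<phi> = \<psi>" by (intro adj_unique A B)
  with inv show ?thesis by (simp add: unitary_def)
qed

section \<open>Forms on the unit and on tensor products\<close>

lemma f_unit: "f I = lunit C I"
  and f_tens: "A \<in> Ob \<Longrightarrow> B \<in> Ob \<Longrightarrow>
    f (T A B) = lunit C I \<circ> tmor C (T A A) (T B B) I I (f A) (f B) \<circ> middle_symm C A B A B"
  using compatible unfolding tensor_compatible_def Let_def by blast+

lemma bf_unit: "bf I (s *\<^sub>R u) (t *\<^sub>R u) = s * t"
  by (simp add: bf_def f_unit lunit_tv unit_obj unit_in coord_unit)

text \<open>Compatibility with tensor products enters here: \<open>middle_symm\<close> brings the
  two left and the two right factors together, each pair is evaluated by its own form, and
  \<open>lunit C I\<close> multiplies the two numbers.\<close>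

lemma bf_tens:
  assumes "A \<in> Ob" "B \<in> Ob" "\<alpha> \<in> V A" "\<beta> \<in> V B" "\<alpha>' \<in> V A" "\<beta>' \<in> V B"
  shows "bf (T A B) (tv A B \<alpha> \<beta>) (tv A B \<alpha>' \<beta>') = bf A \<alpha> \<alpha>' * bf B \<beta> \<beta>'"
proof -
  have "f (T A B) (tv (T A B) (T A B) (tv A B \<alpha> \<beta>) (tv A B \<alpha>' \<beta>')) = (bf A \<alpha> \<alpha>' * bf B \<beta> \<beta>') *\<^sub>R u"
    using assms by (simp add: f_tens middle_symm_tv tmor_tv tens_obj unit_obj tv_in hom_lin f_hom f_tv lunit_tv unit_in)
  then show ?thesis by (simp add: bf_def[of "T A B"] coord_unit)
qed

text \<open>Both sides are biadditive and product vectors generate, so an induction on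
  \<open>x\<close> and then on \<open>y\<close> suffices. Four maps are allowed in order to cover
  isometries, with identities on the right, and adjoints, with one identity on each side.\<close>

lemma bf_eq2:
  assumes "A \<in> Ob" "B \<in> Ob" "D \<in> Ob" "E \<in> Ob" "X \<in> Ob" "Y \<in> Ob"
    and h: "\<phi> \<in> hom C (T A B) X" "\<psi> \<in> hom C (T D E) X" "\<phi>' \<in> hom C (T A B) Y" "\<psi>' \<in> hom C (T D E) Y"
    and eq: "\<And>a b d e. a \<in> V A \<Longrightarrow> b \<in> V B \<Longrightarrow> d \<in> V D \<Longrightarrow> e \<in> V E \<Longrightarrow>
      bf X (\<phi> (tv A B a b)) (\<psi> (tv D E d e)) = bf Y (\<phi>' (tv A B a b)) (\<psi>' (tv D E d e))"
    and x: "x \<in> V (T A B)" and y: "y \<in> V (T D E)"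
  shows "bf X (\<phi> x) (\<psi> y) = bf Y (\<phi>' x) (\<psi>' y)"
proof -
  have l: "\<phi> \<in> lin_maps (V (T A B)) (V X)" "\<psi> \<in> lin_maps (V (T D E)) (V X)"
    "\<phi>' \<in> lin_maps (V (T A B)) (V Y)" "\<psi>' \<in> lin_maps (V (T D E)) (V Y)"
    using assms(1-6) h by (simp_all add: hom_lin tens_obj)
  note ls = lin_maps_in[OF l(1)] lin_maps_in[OF l(2)] lin_maps_in[OF l(3)] lin_maps_in[OF l(4)]
     lin_maps_add[OF l(1)] lin_maps_add[OF l(2)] lin_maps_add[OF l(3)] lin_maps_add[OF l(4)]
  from assms(1,2) x show ?thesis
  proof (induction x rule: tensor_induct)
    case (tv a b)
    from assms(3,4) y show ?case
      by (induction y rule: tensor_induct) (simp_all add: eq tv assms(1-6) ls tv_in bf_linear)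
  next
    case (add z z')
    with y show ?case by (simp add: ls bf_linear assms(5,6))
  qed
qed

section \<open>Dagger compactness\<close>

lemma bf_isometry:
  assumes "A \<in> Ob" "B \<in> Ob" "X \<in> Ob" and \<phi>: "\<phi> \<in> hom C (T A B) X"
    and eq: "\<And>a b a' b'. a \<in> V A \<Longrightarrow> b \<in> V B \<Longrightarrow> a' \<in> V A \<Longrightarrow> b' \<in> V B \<Longrightarrow>
      bf X (\<phi> (tv A B a b)) (\<phi> (tv A B a' b')) = bf (T A B) (tv A B a b) (tv A B a' b')"
    and x: "x \<in> V (T A B)" and y: "y \<in> V (T A B)"
  shows "bf X (\<phi> x) (\<phi> y) = bf (T A B) x y"
proof -
  have "bf X (\<phi> x) (\<phi> y) = bf (T A B) (ident (T A B) x) (ident (T A B) y)"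
    by (rule bf_eq2[OF assms(1,2,1,2,3) _ \<phi> \<phi> ident_hom ident_hom _ x y])
      (simp_all add: tens_obj assms(1,2) eq ident_apply tv_in)
  then show ?thesis using x y by (simp add: ident_apply)
qed

lemma unit_cases:
  assumes "x \<in> V I"
  obtains c where "x = c *\<^sub>R u"
  using unit_eq[OF assms] that by metis

lemma lunit_unitary: "A \<in> Ob \<Longrightarrow> unitary C adj (T I A) A (lunit C A)"
proof (rule adj_inverse[OF tens_obj[OF unit_obj] _ lunit_iso])
  fix x y assume A: "A \<in> Ob" and xy: "x \<in> V (T I A)" "y \<in> V (T I A)"
  show "bf A (lunit C A x) (lunit C A y) = bf (T I A) x y"
  proof (rule bf_isometry[OF unit_obj A A structural_homs(3)[OF A] _ xy])
    fix a b a' b' assume ab: "a \<in> V I" "b \<in> V A" "a' \<in> V I" "b' \<in> V A"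
    \<comment> \<open>Once the unit vectors are multiples of \<open>u\<close>, both sides carry the
      factor \<open>s * t\<close>, on the right through \<open>bf_unit\<close>.\<close>
    then obtain s t where "a = s *\<^sub>R u" "a' = t *\<^sub>R u" using unit_cases by meson
    with ab A show "bf A (lunit C A (tv I A a b)) (lunit C A (tv I A a' b')) = bf (T I A) (tv I A a b) (tv I A a' b')"
      by (simp add: lunit_tv bf_tens unit_obj unit_in bf_unit bf_linear subspace_scale obj_subspace)
  qed
qed

lemma runit_unitary: "A \<in> Ob \<Longrightarrow> unitary C adj (T A I) A (runit C A)"
proof (rule adj_inverse[OF tens_obj[OF _ unit_obj] _ runit_iso])
  fix x y assume A: "A \<in> Ob" and xy: "x \<in> V (T A I)" "y \<in> V (T A I)"
  show "bf A (runit C A x) (runit C A y) = bf (T A I) x y"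
  proof (rule bf_isometry[OF A unit_obj A structural_homs(5)[OF A] _ xy])
    fix a b a' b' assume ab: "a \<in> V A" "b \<in> V I" "a' \<in> V A" "b' \<in> V I"
    then obtain s t where "b = s *\<^sub>R u" "b' = t *\<^sub>R u" using unit_cases by meson
    with ab A show "bf A (runit C A (tv A I a b)) (runit C A (tv A I a' b')) = bf (T A I) (tv A I a b) (tv A I a' b')"
      by (simp add: runit_tv bf_tens unit_obj unit_in bf_unit bf_linear subspace_scale obj_subspace)
  qed
qed

lemma symm_unitary:
  assumes A: "A \<in> Ob" and B: "B \<in> Ob"
  shows "unitary C adj (T A B) (T B A) (symm C A B)"
proof (rule adj_inverse[OF tens_obj tens_obj symm_iso])
  fix x y assume xy: "x \<in> V (T A B)" "y \<in> V (T A B)"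
  show "bf (T B A) (symm C A B x) (symm C A B y) = bf (T A B) x y"
    by (rule bf_isometry[OF A B tens_obj[OF B A] structural_homs(7)[OF A B] _ xy])
      (simp_all add: A B symm_tv bf_tens)
qed (fact A B)+

text \<open>\<open>bf_isometry\<close> splits only the outer tensor product, so the identity is
  first proved for arbitrary left factors in \<open>T A B\<close>, by an induction on each of
  them.\<close>

lemma assoc_unitary:
  assumes A: "A \<in> Ob" and B: "B \<in> Ob" and D: "D \<in> Ob"
  shows "unitary C adj (T (T A B) D) (T A (T B D)) (assoc C A B D)"
proof (rule adj_inverse[OF tens_obj[OF tens_obj] tens_obj[OF _ tens_obj] assoc_iso])
  let ?a = "assoc C A B D" and ?t = "\<lambda>\<omega> \<delta>. tv (T A B) D \<omega> \<delta>"
  note lin = hom_lin[OF tens_obj[OF tens_obj[OF A B] D] tens_obj[OF A tens_obj[OF B D]] structural_homs(1)[OF A B D]]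
  note simps = tv_linear bf_linear tens_obj tv_in A B D lin_maps_in[OF lin] lin_maps_add[OF lin]
  have eq: "bf (T A (T B D)) (?a (?t \<omega> \<delta>)) (?a (?t \<omega>' \<delta>')) = bf (T (T A B) D) (?t \<omega> \<delta>) (?t \<omega>' \<delta>')"
    if "\<omega> \<in> V (T A B)" "\<omega>' \<in> V (T A B)" and \<delta>: "\<delta> \<in> V D" "\<delta>' \<in> V D" for \<omega> \<omega>' \<delta> \<delta>'
    using A B that(1)
  proof (induction \<omega> rule: tensor_induct)
    case (tv a b)
    from A B that(2) show ?case
      by (induction \<omega>' rule: tensor_induct) (simp_all add: tv \<delta> assoc_tv bf_tens simps)
  next
    case (add z z')
    with that(2) show ?case by (simp add: \<delta> simps)
  qed
  fix x y assume xy: "x \<in> V (T (T A B) D)" "y \<in> V (T (T A B) D)"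
  show "bf (T A (T B D)) (?a x) (?a y) = bf (T (T A B) D) x y"
    by (rule bf_isometry[OF tens_obj[OF A B] D tens_obj[OF A tens_obj[OF B D]] structural_homs(1)[OF A B D] _ xy])
      (simp_all add: A B D tens_obj eq)
qed (fact A B D)+

section \<open>Dagger axioms and the compact structure\<close>

lemma adj_tmor:
  assumes "A \<in> Ob" "B \<in> Ob" "A' \<in> Ob" "B' \<in> Ob" and \<phi>: "\<phi> \<in> hom C A A'" and \<psi>: "\<psi> \<in> hom C B B'"
  shows "adj (T A B) (T A' B') (tmor C A B A' B' \<phi> \<psi>) = tmor C A' B' A B (adj A A' \<phi>) (adj B B' \<psi>)"
proof (rule adj_unique)
  let ?p = "tmor C A B A' B' \<phi> \<psi>" and ?q = "tmor C A' B' A B (adj A A' \<phi>) (adj B B' \<psi>)"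
  note h = adj_hom[OF assms(1,3) \<phi>] adj_hom[OF assms(2,4) \<psi>]
  note l = hom_lin[OF assms(1,3) \<phi>] hom_lin[OF assms(2,4) \<psi>] hom_lin[OF assms(3,1) h(1)] hom_lin[OF assms(4,2) h(2)]
  show p: "?p \<in> hom C (T A B) (T A' B')" and q: "?q \<in> hom C (T A' B') (T A B)"
    using assms h by (simp_all add: tmor_hom)
  fix x y assume x: "x \<in> V (T A B)" and y: "y \<in> V (T A' B')"
  \<comment> \<open>The identities bring the adjoint relation into the shape of
    \<open>bf_eq2\<close>. On product vectors it is the product of the relations for
    \<open>\<phi>\<close> and \<open>\<psi>\<close>.\<close>
  have "bf (T A' B') (?p x) (ident (T A' B') y) = bf (T A B) (ident (T A B) x) (?q y)"
    by (rule bf_eq2[OF assms(1-4) _ _ p ident_hom ident_hom q _ x y])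
      (simp_all add: assms(1-4) tens_obj ident_apply tv_in tmor_tv l bf_tens lin_maps_in[OF l(1)] lin_maps_in[OF l(2)]
        lin_maps_in[OF l(3)] lin_maps_in[OF l(4)] bf_adj[OF assms(1,3) \<phi>] bf_adj[OF assms(2,4) \<psi>])
  then show "bf (T A' B') (?p x) y = bf (T A B) x (?q y)" using x y by (simp add: ident_apply)
qed (simp_all add: assms tens_obj)

lemma adj_dagger: "is_dagger C adj"
  unfolding is_dagger_def Let_def
proof (intro conjI ballI)
  fix A B \<phi> assume *: "A \<in> Ob" "B \<in> Ob" "\<phi> \<in> hom C A B"
  show "adj A B \<phi> \<in> hom C B A" using * by (rule adj_hom)
  note h = lin_maps_in[OF hom_lin[OF *]] lin_maps_in[OF hom_lin[OF *(2,1) adj_hom[OF *]]]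
  show "adj B A (adj A B \<phi>) = \<phi>"
    \<comment> \<open>Symmetry of both forms lets the adjoint relation be read backwards, which
      makes \<open>\<phi>\<close> an adjoint of its adjoint.\<close>
    using * by (intro adj_unique adj_hom) (simp_all add: bf_commute[of A _ "_ :: 'v"] bf_commute[of B] bf_adj h)
next
  fix A assume "A \<in> Ob"
  then show "adj A A (ident A) = ident A"
    by (intro adj_unique ident_hom) (simp_all add: ident_apply)
next
  fix A B D \<phi> \<psi> assume *: "A \<in> Ob" "B \<in> Ob" "D \<in> Ob" "\<phi> \<in> hom C A B" "\<psi> \<in> hom C B D"
  note h = lin_maps_in[OF hom_lin[OF *(1,2,4)]] lin_maps_in[OF hom_lin[OF *(3,2) adj_hom[OF *(2,3,5)]]]
  show "adj A D (\<psi> \<circ> \<phi>) = adj A B \<phi> \<circ> adj B D \<psi>"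
  proof (rule adj_unique)
    show "\<psi> \<circ> \<phi> \<in> hom C A D" "adj A B \<phi> \<circ> adj B D \<psi> \<in> hom C D A"
      by (rule comp_hom adj_hom *)+
  qed (simp_all add: * h bf_adj)
qed

text \<open>Evaluated at a vector, the two snake composites are the sums of
  \<open>expand_right\<close> and \<open>expand_left\<close>.\<close>

lemma self_is_dual:
  assumes A: "A \<in> Ob"
  shows "is_dual C A A (\<gamma> A) (f A)"
proof -
  obtain S x y where dec: "decomposes A S x y" using decomposition[OF A] .
  note d = decomposesD[OF dec]
  note obs = A tens_obj unit_obj
  let ?m = "lunit C A \<circ> tmor C (T A A) A I A (f A) (ident A) \<circ> assoc_inv C A A A"
  let ?n = "runit C A \<circ> tmor C A (T A A) A I (ident A) (f A) \<circ> assoc C A A A"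
  have m: "?m \<in> hom C (T A (T A A)) A" and n: "?n \<in> hom C (T (T A A) A) A"
    by (rule comp_hom tmor_hom structural_homs f_hom obs)+
  have ml: "?m \<in> lin_maps (V (T A (T A A))) (V A)" and nl: "?n \<in> lin_maps (V (T (T A A) A)) (V A)"
    by (rule hom_lin m n obs)+
  have "?m \<circ> tmor C A I A (T A A) (ident A) (\<gamma> A) \<circ> runit_inv C A \<in> hom C A A"
    by (rule comp_hom m tmor_hom structural_homs gamma_hom obs)+
  then have 1: "?m \<circ> tmor C A I A (T A A) (ident A) (\<gamma> A) \<circ> runit_inv C A = ident A"
  proof (rule lin_maps_eqI[OF hom_lin[OF A A] hom_lin[OF A A ident_hom[OF A]]])
    fix \<alpha> assume \<alpha>: "\<alpha> \<in> V A"
    have "(?m \<circ> tmor C A I A (T A A) (ident A) (\<gamma> A) \<circ> runit_inv C A) \<alpha> =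
        ?m (\<Sum>i\<in>S. tv A (T A A) \<alpha> (tv A A (x i) (y i)))"
      using \<alpha> d A by (simp add: runit_inv_def tmor_tv obs unit_in hom_lin ident_hom gamma_hom ident_apply tv_sum_right tv_in)
    also have "\<dots> = (\<Sum>i\<in>S. ?m (tv A (T A A) \<alpha> (tv A A (x i) (y i))))"
      by (rule lin_maps_sum[OF obj_subspace ml]) (simp_all add: obs \<alpha> d tv_in)
    also have "\<dots> = (\<Sum>i\<in>S. bf A \<alpha> (x i) *\<^sub>R y i)"
      using \<alpha> d by (simp add: obs assoc_inv_tv tmor_tv tv_in hom_lin f_hom ident_hom ident_apply f_tv lunit_tv)
    also have "\<dots> = ident A \<alpha>"
      using expand_right[OF A dec \<alpha>] \<alpha> by (simp add: ident_apply)
    finally show "(?m \<circ> tmor C A I A (T A A) (ident A) (\<gamma> A) \<circ> runit_inv C A) \<alpha> = ident A \<alpha>" .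
  qed
  have "?n \<circ> tmor C I A (T A A) A (\<gamma> A) (ident A) \<circ> lunit_inv C A \<in> hom C A A"
    by (rule comp_hom n tmor_hom structural_homs gamma_hom obs)+
  then have 2: "?n \<circ> tmor C I A (T A A) A (\<gamma> A) (ident A) \<circ> lunit_inv C A = ident A"
  proof (rule lin_maps_eqI[OF hom_lin[OF A A] hom_lin[OF A A ident_hom[OF A]]])
    fix \<alpha> assume \<alpha>: "\<alpha> \<in> V A"
    have "(?n \<circ> tmor C I A (T A A) A (\<gamma> A) (ident A) \<circ> lunit_inv C A) \<alpha> =
        ?n (\<Sum>i\<in>S. tv (T A A) A (tv A A (x i) (y i)) \<alpha>)"
      using \<alpha> d A by (simp add: lunit_inv_def tmor_tv obs unit_in hom_lin ident_hom gamma_hom ident_apply tv_sum_left tv_in)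
    also have "\<dots> = (\<Sum>i\<in>S. ?n (tv (T A A) A (tv A A (x i) (y i)) \<alpha>))"
      by (rule lin_maps_sum[OF obj_subspace nl]) (simp_all add: obs \<alpha> d tv_in)
    also have "\<dots> = (\<Sum>i\<in>S. bf A (y i) \<alpha> *\<^sub>R x i)"
      using \<alpha> d by (simp add: obs assoc_tv tmor_tv tv_in hom_lin f_hom ident_hom ident_apply f_tv runit_tv)
    also have "\<dots> = ident A \<alpha>"
      using expand_left[OF A dec \<alpha>] \<alpha> by (simp add: ident_apply)
    finally show "(?n \<circ> tmor C I A (T A A) A (\<gamma> A) (ident A) \<circ> lunit_inv C A) \<alpha> = ident A \<alpha>" .
  qed
  show ?thesis
    unfolding is_dual_def Let_def using 1 2 A by (simp add: gamma_hom f_hom)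
qed

lemma adj_f:
  assumes A: "A \<in> Ob"
  shows "adj (T A A) I (f A) = \<gamma> A"
proof (rule adj_unique[OF tens_obj[OF A A] unit_obj f_hom[OF A] gamma_hom[OF A]])
  obtain S x y where dec: "decomposes A S x y" using decomposition[OF A] .
  note d = decomposesD[OF dec]
  note gl = hom_lin[OF unit_obj tens_obj[OF A A] gamma_hom[OF A]]
  note fl = hom_lin[OF tens_obj[OF A A] unit_obj f_hom[OF A]]
  have \<gamma>V: "\<gamma> A u \<in> V (T A A)" using lin_maps_in[OF gl unit_in(2)] .
  fix \<omega> s assume "\<omega> \<in> V (T A A)" "s \<in> V I"
  from this(2) obtain c where s: "s = c *\<^sub>R u" by (rule unit_cases)
  have gs: "\<gamma> A (c *\<^sub>R u) = c *\<^sub>R \<gamma> A u" by (simp add: lin_maps_scale[OF gl] unit_in)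
  from A A \<open>\<omega> \<in> V (T A A)\<close> show "bf I (f A \<omega>) s = bf (T A A) \<omega> (\<gamma> A s)"
  proof (induction \<omega> rule: tensor_induct)
    case (tv a b)
    \<comment> \<open>The terms of the state enter with coefficient 1, and the form on
      \<open>T A A\<close> multiplies those of the factors.\<close>
    have "bf (T A A) (tv A A a b) (\<gamma> A u) = (\<Sum>i\<in>S. bf A a (x i) * bf A b (y i))"
      using bf_sum_right[of "T A A" "\<lambda>i. tv A A (x i) (y i)" "tv A A a b" "\<lambda>i. 1" S] d tv A
      by (simp add: tens_obj tv_in bf_tens)
    also have "\<dots> = bf A b (\<Sum>i\<in>S. bf A a (x i) *\<^sub>R y i)"
      using d tv A by (simp add: bf_sum_right)
    \<comment> \<open>The expansion produces the arguments in the order \<open>b\<close>,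
      \<open>a\<close>; symmetry of the form restores the order.\<close>
    also have "\<dots> = bf A a b"
      using expand_right[OF A dec tv(1)] bf_commute[OF A tv] by simp
    finally show ?case
      using tv A \<gamma>V by (simp add: gs f_tv s bf_unit bf_linear tens_obj tv_in)
  next
    case (add z z')
    then show ?case
      using lin_maps_in[OF gl \<open>s \<in> V I\<close>] \<open>s \<in> V I\<close>
      by (simp add: lin_maps_add[OF fl] lin_maps_in[OF fl] bf_linear A tens_obj unit_obj)
  qed
qed

end

theorem theorem24:
  fixes C :: "'v::real_normed_vector com_cat"
    and \<gamma> f :: "'v com \<Rightarrow> 'v \<Rightarrow> 'v"
  assumes "monoidal_com_category C"
    and "symmetrically_self_dual_structure C \<gamma> f"
    and "tensor_compatible C \<gamma> f"
  shows "dagger_compact C (canonical_adjoint C \<gamma> f) (\<lambda>A. A) \<gamma> f"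
proof -
  interpret self_dual_coms C \<gamma> f by unfold_locales fact+
  show ?thesis
    unfolding dagger_compact_def dagger_monoidal_def Let_def
    \<comment> \<open>Since the adjoint of \<open>f A\<close> is the state itself, the compatibility
      of unit and counit becomes the symmetry of the state.\<close>
    by (intro conjI ballI sym_monoidal adj_dagger assoc_unitary lunit_unitary runit_unitary symm_unitary adj_tmor
      self_is_dual) (simp_all add: adj_f gamma_symm)
qed

end
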